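(* Let $\mathbf{E}$ be a finite set, $n\in\mathbb{N}$, $\mathsf{G}_{1},\ldots,\mathsf{G}_{n+1}$ be $|\mathbf{E}|\times|\mathbf{E}|$ matrices with non-negative off-diagonal entries and zero row sums, $v:\mathbf{E}\to\mathbb{R}\setminus\{0\}$, $\mathbf{E}^{\pm}=\{i:\pm v(i)>0\}$, and $c>0$. For $0<s_1<\cdots<s_n$, let $X$ be a time-inhomogeneous Markov chain on $\mathbf{E}$ (with $\mathbb{P}(X_0=i)>0$ for all $i$) with generator $\mathsf{G}_t=\mathsf{G}_k$ for $s_{k-1}\le t<s_k$ ($k=1,\ldots,n$, $s_0=0$) and $\mathsf{G}_t=\mathsf{G}_{n+1}$ for $t\ge s_n$; let $\varphi_t=\int_0^tv(X_u)du$, $\tau^+_t=\inf\{r\ge0:\varphi_r>t\}$, and $$\Pi^+_c(i,j;s_1,\ldots,s_n)=\mathbb{E}\big(e^{-c\tau_0^+}\mathbf{1}_{\{X_{\tau^+_0}=j\}}\mid X_0=i\big),\qquad \Psi^+_c(t,i,j;s_1,\ldots,s_n)=\mathbb{E}\big(e^{-c\tau_t^+}\mathbf{1}_{\{X_{\tau^+_t}=j\}}\mid X_0=i\big).$$ For $q_1,\ldots,q_n>0$, let $Z=(N,Y)$ be a time-homogeneous Markov chain on $\{0,\ldots,n\}\times\mathbf{E}$ with generator $\widetilde{\mathsf{G}}$ having diagonal blocks $\mathsf{G}_{k+1}-q_{k+1}\mathsf{I}$ on $\{k\}\times\mathbf{E}$ ($k<n$) and $\mathsf{G}_{n+1}$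 on $\{n\}\times\mathbf{E}$, blocks $q_{k+1}\mathsf{I}$ from $\{k\}\times\mathbf{E}$ to $\{k+1\}\times\mathbf{E}$, other blocks zero; let $\widetilde{\mathbb{E}}^{i}$ be expectation conditional on $Z_0=(0,i)$, $\widetilde{\varphi}_t=\int_0^t v(Y_u)du$, $\widetilde{\tau}^+_t=\inf\{r\ge0:\widetilde{\varphi}_r>t\}$, and define $$\widehat{\Pi}^+_c(i,j;q_1,\ldots,q_n)=\widetilde{\mathbb{E}}^{i}\big(e^{-c\widetilde{\tau}^+_0}\mathbf{1}_{\{Y_{\widetilde{\tau}^+_0}=j\}}\big),\qquad \widehat{\Psi}^+_c(t,i,j;q_1,\ldots,q_n)=\widetilde{\mathbb{E}}^{i}\big(e^{-c\widetilde{\tau}^+_t}\mathbf{1}_{\{Y_{\widetilde{\tau}^+_t}=j\}}\big).$$ Then for $i\in\mathbf{E}^-$, $j\in\mathbf{E}^+$, $$\Pi^+_c(i,j;s_1,\ldots,s_n)=\mathcal{L}^{-1}\Big(q_1^{-1}\cdots q_n^{-1}\widehat{\Pi}^+_c(i,j;q_1,\ldots,q_n)\Big)(s_1,s_2-s_1,\ldots,s_n-s_{n-1}),$$ and for any $t>0$ and $i,j\in\mathbf{E}^+$, $$\Psi^+_c(t,i,j;s_1,\ldots,s_n)=\mathcal{L}^{-1}\Big(q_1^{-1}\cdots q_n^{-1}\widehat{\Psi}^+_c(t,i,j;q_1,\ldots,q_n)\Big)(s_1,s_2-s_1,\ldots,s_n-s_{n-1}),$$ where $\mathcal{L}^{-1}$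 denotes the inverse multivariate Laplace transform (with respect to $(q_1,\ldots,q_n)$).
   Context: For a Borel function $f:[0,\infty)^n\to[0,\infty)$, its multivariate Laplace transform is $\mathcal{L}(f)(q_1,\ldots,q_n)=\int_{[0,\infty)^n}f(t_1,\ldots,t_n)\prod_k e^{-q_kt_k}\,dt_1\cdots dt_n$, defined for $\Re(q_k)>0$; the inverse multivariate Laplace transform $\mathcal{L}^{-1}(g)$ of a function $g$ is the function $\check g$ with $\mathcal{L}(\check g)=g$. *)

theory Defs
  imports "HOL-Probability.Probability"
begin

type_synonym 's mat = "'s \<Rightarrow> 's \<Rightarrow> real"

definition mat_mult :: "'s set \<Rightarrow> 's mat \<Rightarrow> 's mat \<Rightarrow> 's mat" where
  "mat_mult S A B = (\<lambda>i j. \<Sum>k\<in>S. A i k * B k j)"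

definition mat_id :: "'s mat" where
  "mat_id = (\<lambda>i j. if i = j then 1 else 0)"

definition mat_scale :: "real \<Rightarrow> 's mat \<Rightarrow> 's mat" where
  "mat_scale r A = (\<lambda>i j. r * A i j)"

fun mat_pow :: "'s set \<Rightarrow> 's mat \<Rightarrow> nat \<Rightarrow> 's mat" where
  "mat_pow S A 0 = mat_id"
| "mat_pow S A (Suc m) = mat_mult S A (mat_pow S A m)"

definition mat_exp :: "'s set \<Rightarrow> 's mat \<Rightarrow> 's mat" where
  "mat_exp S A = (\<lambda>i j. \<Sum>m. mat_pow S A m i j / fact m)"

definition is_generator :: "'s set \<Rightarrow> 's mat \<Rightarrow> bool" where
  "is_generator S G \<longleftrightarrow> (\<forall>i\<in>S. \<forall>j\<in>S. i \<noteq> j \<longrightarrow> 0 \<le> G i j) \<and> (\<forall>i\<in>S. (\<Sum>j\<in>S. G i j) = 0)"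

text \<open>Length of the part of [a,b] lying in the k-th piece [s_{k-1}, s_k) (s_0 = 0,
  the (n+1)-th piece is [s_n, infinity)).\<close>
definition piece_len :: "nat \<Rightarrow> (nat \<Rightarrow> real) \<Rightarrow> nat \<Rightarrow> real \<Rightarrow> real \<Rightarrow> real" where
  "piece_len n s k a b =
     (let l = (if k = 1 then 0 else s (k - 1)) in
      if k = n + 1 then max 0 (b - max a l) else max 0 (min b (s k) - max a l))"

definition pw_trans :: "'s set \<Rightarrow> (nat \<Rightarrow> 's mat) \<Rightarrow> nat \<Rightarrow> (nat \<Rightarrow> real) \<Rightarrow> real \<Rightarrow> real \<Rightarrow> 's mat" where
  "pw_trans S G n s a b =
     fold (\<lambda>k P. mat_mult S P (mat_exp S (mat_scale (piece_len n s k a b) (G k)))) [1..<n+2] mat_id"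

definition incr_times :: "nat \<Rightarrow> (nat \<Rightarrow> real) \<Rightarrow> bool" where
  "incr_times n s \<longleftrightarrow> (n \<ge> 1 \<longrightarrow> 0 < s 1) \<and> (\<forall>k\<in>{1..<n}. s k < s (Suc k))"

definition markov_chain ::
  "'a measure \<Rightarrow> 's set \<Rightarrow> (real \<Rightarrow> real \<Rightarrow> 's mat) \<Rightarrow> (real \<Rightarrow> 'a \<Rightarrow> 's) \<Rightarrow> bool" where
  "markov_chain M S P X \<longleftrightarrow>
     prob_space M \<and> finite S \<and>
     (\<forall>t\<ge>0. X t \<in> M \<rightarrow>\<^sub>M count_space UNIV) \<and>
     (\<forall>\<omega>\<in>space M. \<forall>t\<ge>0. X t \<omega> \<in> S) \<and>
     (\<forall>\<omega>\<in>space M. \<forall>t\<ge>0. \<exists>\<delta>>0. \<forall>r. t \<le> r \<and> r < t + \<delta> \<longrightarrow> X r \<omega> = X t \<omega>) \<and>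
     (\<forall>\<omega>\<in>space M. \<forall>t>0. \<exists>\<delta>>0. \<delta> \<le> t \<and> (\<exists>e. \<forall>r. t - \<delta> < r \<and> r < t \<longrightarrow> X r \<omega> = e)) \<and>
     (\<forall>(ts::real list) (is::'s list). length is = length ts + 1 \<longrightarrow> sorted (0 # ts) \<longrightarrow>
        measure M {\<omega>\<in>space M. \<forall>k<length is. X ((0 # ts) ! k) \<omega> = is ! k} =
        measure M {\<omega>\<in>space M. X 0 \<omega> = is ! 0} *
          (\<Prod>k<length ts. P ((0 # ts) ! k) (ts ! k) (is ! k) (is ! Suc k)))"

definition occ :: "('e \<Rightarrow> real) \<Rightarrow> (real \<Rightarrow> 'e) \<Rightarrow> real \<Rightarrow> real" where
  "occ v y t = integral {0..t} (\<lambda>u. v (y u))"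

definition fpt :: "('e \<Rightarrow> real) \<Rightarrow> (real \<Rightarrow> 'e) \<Rightarrow> real \<Rightarrow> real" where
  "fpt v y t = Inf {r. 0 \<le> r \<and> occ v y r > t}"

text \<open>e^{-c tau_t^+} 1{y(tau_t^+) = j}, with the convention e^{-c infinity} = 0.\<close>
definition passage_fun :: "real \<Rightarrow> ('e \<Rightarrow> real) \<Rightarrow> (real \<Rightarrow> 'e) \<Rightarrow> real \<Rightarrow> 'e \<Rightarrow> real" where
  "passage_fun c v y t j =
     (if \<exists>r\<ge>0. occ v y r > t
      then exp (- c * fpt v y t) * (if y (fpt v y t) = j then 1 else 0) else 0)"

definition cond_exp_start :: "'a measure \<Rightarrow> (real \<Rightarrow> 'a \<Rightarrow> 's) \<Rightarrow> 's \<Rightarrow> ('a \<Rightarrow> real) \<Rightarrow> real" where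
  "cond_exp_start M X i f =
     (\<integral>\<omega>. f \<omega> * indicator {\<omega>\<in>space M. X 0 \<omega> = i} \<omega> \<partial>M) / measure M {\<omega>\<in>space M. X 0 \<omega> = i}"

definition aug_gen :: "nat \<Rightarrow> (nat \<Rightarrow> 'e mat) \<Rightarrow> (nat \<Rightarrow> real) \<Rightarrow> (nat \<times> 'e) mat" where
  "aug_gen n G q = (\<lambda>(k, a) (l, b).
     if l = k then (if k < n then G (k + 1) a b - (if a = b then q (k + 1) else 0)
                    else G (n + 1) a b)
     else if l = k + 1 \<and> k < n then (if a = b then q (k + 1) else 0)
     else 0)"

definition pos_orthant :: "nat \<Rightarrow> (nat \<Rightarrow> real) set" where
  "pos_orthant n = {u. \<forall>k\<in>{1..n}. 0 < u k}"

definition psums :: "(nat \<Rightarrow> real) \<Rightarrow> (nat \<Rightarrow> real)" where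
  "psums u = (\<lambda>k. \<Sum>l\<in>{1..k}. u l)"

definition is_inv_laplace :: "nat \<Rightarrow> ((nat \<Rightarrow> real) \<Rightarrow> real) \<Rightarrow> ((nat \<Rightarrow> real) \<Rightarrow> real) \<Rightarrow> bool" where
  "is_inv_laplace n f g \<longleftrightarrow>
     (\<lambda>u. indicator (pos_orthant n) u * f u) \<in> borel_measurable (PiM {1..n} (\<lambda>_. lborel)) \<and>
     (\<forall>q. (\<forall>k\<in>{1..n}. 0 < q k) \<longrightarrow>
        (\<integral>\<^sup>+ u\<in>pos_orthant n. ennreal (f u * exp (- (\<Sum>k\<in>{1..n}. q k * u k))) \<partial>PiM {1..n} (\<lambda>_. lborel))
          = ennreal (g q))"

end

theory Submission
  imports Defs
begin

text \<open>Under the augmented chain the level component leaves level k at rate q (k + 1), so the times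
  spent in levels 0, ..., n - 1 are independent exponentials, and given these times the second
  component is a copy of the time-inhomogeneous chain switching generators at their partial sums.
  Hence its law on path space is the mixture of the laws of that chain over exponentially distributed
  u, with density the product of the q k * exp (- q k * u k), and integrating the passage
  functional against this mixture is the Laplace identity. The mixture identity is only needed on
  cylinder sets, where both sides satisfy the renewal equation obtained by conditioning on the first
  level change; for the augmented chain that equation is Duhamel's formula.\<close>

section \<open>The matrix exponential of a generator\<close>

text \<open>The chains \<open>X s\<close> for different \<open>s\<close> live on unrelated
  probability spaces, so the conditional expectations come with no measurability in the switching
  times, which the Laplace integral needs. It is obtained by transporting every law to one space of
  right-continuous paths: the mass of a cylinder is an explicit measurable function of the piece
  lengths, cylinders generate the sigma-algebra and are stable under intersection, hence the laws
  form a measurable kernel. The same stability extends the mixture identity from cylinders to all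
  path events, and right-continuity makes the passage functional measurable on that space. The
  coordinates are piece lengths, not switching times, because restarting the clock then merely drops
  or shortens the first length; this is also why the inverse transform is evaluated at the
  differences of the switching times. The factor \<open>1 / q k\<close> in the transform cancels the
  normalising constant of the k-th exponential density and leaves the Laplace kernel.\<close>

abbreviation mexp :: "'s set \<Rightarrow> 's mat \<Rightarrow> real \<Rightarrow> 's mat" where
  "mexp S A t \<equiv> mat_exp S (mat_scale t A)"

lemma mat_pow_scale: "mat_pow S (mat_scale t A) m i j = t ^ m * mat_pow S A m i j"
  by (induction m arbitrary: i)
     (auto simp: mat_mult_def mat_scale_def sum_distrib_left algebra_simps intro!: sum.cong)

text \<open>Needed for the forward equation. Membership in \<open>S\<close> matters since
  \<open>mat_id\<close> is the identity on the whole type while \<open>mat_mult\<close> sums over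
  \<open>S\<close> only.\<close>

lemma mat_pow_Suc_right:
  assumes "finite S" "i \<in> S" "j \<in> S"
  shows "mat_pow S A (Suc m) i j = (\<Sum>k\<in>S. mat_pow S A m i k * A k j)"
  using assms
proof (induction m arbitrary: i)
  case 0
  then show ?case
    by (simp add: mat_mult_def mat_id_def if_distrib[of "\<lambda>x. _ * x"] if_distrib[of "\<lambda>x. x * _"]
        sum.delta cong: if_cong)
next
  case (Suc m)
  have "mat_pow S A (Suc (Suc m)) i j = (\<Sum>k\<in>S. A i k * mat_pow S A (Suc m) k j)"
    by (simp add: mat_mult_def)
  also have "\<dots> = (\<Sum>k\<in>S. \<Sum>l\<in>S. A i k * (mat_pow S A m k l * A l j))"
    using Suc by (intro sum.cong refl) (simp only: sum_distrib_left)
  also have "\<dots> = (\<Sum>l\<in>S. \<Sum>k\<in>S. A i k * (mat_pow S A m k l * A l j))"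
    by (rule sum.swap)
  also have "\<dots> = (\<Sum>l\<in>S. mat_pow S A (Suc m) i l * A l j)"
    by (simp add: mat_mult_def sum_distrib_right mult.assoc)
  finally show ?case .
qed

lemma mat_pow_bound:
  assumes "finite S" and C: "\<And>i j. i \<in> S \<Longrightarrow> j \<in> S \<Longrightarrow> \<bar>A i j\<bar> \<le> C" and "i \<in> S" "j \<in> S"
  shows "\<bar>mat_pow S A m i j\<bar> \<le> (real (card S) * C) ^ m"
  using assms(3)
proof (induction m arbitrary: i)
  case 0
  then show ?case by (simp add: mat_id_def)
next
  case (Suc m)
  have "C \<ge> 0" using C[OF assms(4) assms(4)] by linarith
  have "\<bar>mat_pow S A (Suc m) i j\<bar> \<le> (\<Sum>k\<in>S. \<bar>A i k * mat_pow S A m k j\<bar>)"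
    by (simp add: mat_mult_def sum_abs)
  also have "\<dots> \<le> (\<Sum>k\<in>S. C * (real (card S) * C) ^ m)"
    using Suc C \<open>C \<ge> 0\<close> by (intro sum_mono) (auto simp: abs_mult intro!: mult_mono)
  finally show ?case by simp
qed

lemma summable_mexp:
  assumes "finite S" "i \<in> S" "j \<in> S"
  shows "summable (\<lambda>m. mat_pow S A m i j / fact m * t ^ m)"
proof -
  define C where "C = (\<Sum>i\<in>S. \<Sum>j\<in>S. \<bar>A i j\<bar>)"
  have C: "\<bar>A i j\<bar> \<le> C" if "i \<in> S" "j \<in> S" for i j
  proof -
    have "\<bar>A i j\<bar> \<le> (\<Sum>j\<in>S. \<bar>A i j\<bar>)"
      using assms that by (intro member_le_sum) auto
    also have "\<dots> \<le> C" unfolding C_def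
      using assms that by (intro member_le_sum[of i S "\<lambda>i. \<Sum>j\<in>S. \<bar>A i j\<bar>"]) (auto intro: sum_nonneg)
    finally show ?thesis .
  qed
  have "summable (\<lambda>m. inverse (fact m) * (real (card S) * C * \<bar>t\<bar>) ^ m)"
    by (rule summable_exp)
  then show ?thesis
  proof (rule summable_comparison_test'[of _ 0])
    fix m :: nat
    have "norm (mat_pow S A m i j / fact m * t ^ m) = \<bar>mat_pow S A m i j\<bar> * (inverse (fact m) * \<bar>t\<bar> ^ m)"
      by (simp add: abs_mult power_abs field_simps)
    also have "\<dots> \<le> (real (card S) * C) ^ m * (inverse (fact m) * \<bar>t\<bar> ^ m)"
      using mat_pow_bound[OF assms(1) C assms(2,3)] by (intro mult_right_mono) auto
    finally show "norm (mat_pow S A m i j / fact m * t ^ m)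
        \<le> inverse (fact m) * (real (card S) * C * \<bar>t\<bar>) ^ m"
      by (simp add: power_mult_distrib mult_ac)
  qed
qed

lemma mexp_series: "mexp S A t i j = (\<Sum>m. mat_pow S A m i j / fact m * t ^ m)"
  by (simp add: mat_exp_def mat_pow_scale mult.commute)

lemma mexp_0: "mexp S A 0 = mat_id"
  by (intro ext) (simp only: mexp_series powser_zero, simp)

lemma mexp_deriv_diffs:
  assumes "finite S" "i \<in> S" "j \<in> S"
  shows "((\<lambda>t. mexp S A t i j) has_real_derivative
      (\<Sum>m. mat_pow S A (Suc m) i j / fact m * t ^ m)) (at t)"
proof -
  have "((\<lambda>t. \<Sum>m. mat_pow S A m i j / fact m * t ^ m) has_real_derivative
      (\<Sum>m. diffs (\<lambda>m. mat_pow S A m i j / fact m) m * t ^ m)) (at t)"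
    using summable_mexp[OF assms] by (rule termdiffs_strong_converges_everywhere)
  moreover have "diffs (\<lambda>m. mat_pow S A m i j / fact m) = (\<lambda>m. mat_pow S A (Suc m) i j / fact m)"
    by (auto simp: diffs_def fun_eq_iff field_simps simp del: mat_pow.simps of_nat_Suc)
  ultimately show ?thesis by (simp add: mexp_series del: mat_pow.simps)
qed

text \<open>Kolmogorov's backward equation, by differentiating the power series termwise.\<close>

lemma mexp_deriv_left:
  assumes "finite S" "i \<in> S" "j \<in> S"
  shows "((\<lambda>t. mexp S A t i j) has_real_derivative (\<Sum>k\<in>S. A i k * mexp S A t k j)) (at t)"
proof -
  have "(\<Sum>k\<in>S. A i k * mexp S A t k j)
      = (\<Sum>k\<in>S. \<Sum>m. A i k * (mat_pow S A m k j / fact m * t ^ m))"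
    unfolding mexp_series using assms by (intro sum.cong refl suminf_mult[symmetric] summable_mexp)
  also have "\<dots> = (\<Sum>m. \<Sum>k\<in>S. A i k * (mat_pow S A m k j / fact m * t ^ m))"
    using assms by (intro suminf_sum[symmetric] summable_mult summable_mexp)
  also have "\<dots> = (\<Sum>m. mat_pow S A (Suc m) i j / fact m * t ^ m)"
    by (simp add: mat_mult_def sum_distrib_right sum_divide_distrib mult.assoc)
  finally show ?thesis using mexp_deriv_diffs[OF assms] by simp
qed

text \<open>The forward equation: the same derived series, with the extra factor \<open>A\<close>
  pulled out on the right.\<close>

lemma mexp_deriv_right:
  assumes "finite S" "i \<in> S" "j \<in> S"
  shows "((\<lambda>t. mexp S A t i j) has_real_derivative (\<Sum>k\<in>S. mexp S A t i k * A k j)) (at t)"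
proof -
  have "(\<Sum>k\<in>S. mexp S A t i k * A k j)
      = (\<Sum>k\<in>S. \<Sum>m. mat_pow S A m i k / fact m * t ^ m * A k j)"
    unfolding mexp_series using assms by (intro sum.cong refl suminf_mult2 summable_mexp)
  also have "\<dots> = (\<Sum>m. \<Sum>k\<in>S. mat_pow S A m i k / fact m * t ^ m * A k j)"
    using assms by (intro suminf_sum[symmetric] summable_mult2 summable_mexp)
  also have "\<dots> = (\<Sum>m. mat_pow S A (Suc m) i j / fact m * t ^ m)"
    using assms by (simp add: mat_pow_Suc_right sum_distrib_left sum_divide_distrib mult_ac del: mat_pow.simps)
  finally show ?thesis using mexp_deriv_diffs[OF assms] by simp
qed

lemma mexp_mat_id_sum:
  assumes "finite S" "i \<in> S"
  shows "(\<Sum>k\<in>S. mat_id i k * f k) = f i" "(\<Sum>k\<in>S. f k * mat_id k i) = f i"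
  using assms by (simp_all add: mat_id_def if_distrib[of "\<lambda>x. _ * x"] if_distrib[of "\<lambda>x. x * _"] cong: if_cong)

text \<open>Duhamel's interpolation. \<open>f\<close> solves a backward equation with killing rate
  \<open>q\<close> and source \<open>g\<close>; running the killed semigroup for time
  \<open>s\<close> and \<open>f\<close> for the remaining \<open>d - s\<close> makes all terms
  cancel except the source. Used with zero source for positivity, and with the inflow from the next
  level for the renewal equation.\<close>

lemma mexp_duhamel_deriv:
  fixes f g :: "'s \<Rightarrow> real \<Rightarrow> real"
  assumes S: "finite S" "i \<in> S"
    and f: "\<And>k t. k \<in> S \<Longrightarrow>
      (f k has_real_derivative (\<Sum>b\<in>S. A k b * f b t) - q * f k t + g k t) (at t)"
  shows "((\<lambda>s. exp (- q * s) * (\<Sum>k\<in>S. mexp S A s i k * f k (d - s))) has_real_derivative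
      - (exp (- q * s) * (\<Sum>k\<in>S. mexp S A s i k * g k (d - s)))) (at s)"
proof -
  let ?E = "\<lambda>k. mexp S A s i k"
  have f': "((\<lambda>s. f k (d - s)) has_real_derivative
      - ((\<Sum>b\<in>S. A k b * f b (d - s)) - q * f k (d - s) + g k (d - s))) (at s)" if "k \<in> S" for k
  proof -
    have "((\<lambda>s. d - s) has_real_derivative - 1) (at s)"
      by (auto intro!: derivative_eq_intros)
    from DERIV_chain2[OF f[OF that] this] show ?thesis by simp
  qed
  have "((\<lambda>s. exp (- q * s) * (\<Sum>k\<in>S. mexp S A s i k * f k (d - s))) has_real_derivative
     (- q * exp (- q * s)) * (\<Sum>k\<in>S. ?E k * f k (d - s)) +
     (\<Sum>k\<in>S. (\<Sum>b\<in>S. ?E b * A b k) * f k (d - s) +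
       - ((\<Sum>b\<in>S. A k b * f b (d - s)) - q * f k (d - s) + g k (d - s)) * ?E k) * exp (- q * s)) (at s)"
    by (intro DERIV_mult DERIV_sum mexp_deriv_right f' S)
       (auto intro!: derivative_eq_intros)
  \<comment> \<open>The forward derivative of the exponential and the matrix term in the derivative
    of \<open>f\<close> are the same double sum, so they cancel.\<close>
  moreover have "(\<Sum>k\<in>S. (\<Sum>b\<in>S. ?E b * A b k) * f k (d - s)) =
      (\<Sum>k\<in>S. (\<Sum>b\<in>S. A k b * f b (d - s)) * ?E k)"
    unfolding sum_distrib_right by (subst sum.swap) (simp add: mult_ac)
  ultimately show ?thesis
    by (simp add: algebra_simps sum.distrib sum_subtractf sum_negf flip: sum_distrib_left)
qed

text \<open>Uniformization: a large multiple of the identity turns \<open>A\<close> into an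
  entrywise non-negative \<open>B\<close>, whose exponential series has non-negative terms, and the
  exponential of \<open>A\<close> is that of \<open>B\<close> times
  \<open>exp (- q * t)\<close>.\<close>

lemma mexp_nonneg:
  assumes S: "finite S" "i \<in> S" "j \<in> S"
    and A: "\<And>i j. i \<in> S \<Longrightarrow> j \<in> S \<Longrightarrow> i \<noteq> j \<Longrightarrow> 0 \<le> A i j" and "0 \<le> t"
  shows "0 \<le> mexp S A t i j"
proof -
  \<comment> \<open>Any bound for all \<open>\<bar>A i i\<bar>\<close> would do; the sum avoids a
    maximum over a possibly awkward set.\<close>
  define q where "q = (\<Sum>i\<in>S. \<bar>A i i\<bar>)"
  define B where "B = (\<lambda>i j. A i j + (if i = j then q else 0))"
  have q: "\<bar>A i i\<bar> \<le> q" if "i \<in> S" for i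
    unfolding q_def using S that by (intro member_le_sum) auto
  have B: "0 \<le> B i j" if "i \<in> S" "j \<in> S" for i j
    using A[OF that] q[OF that(1)] by (auto simp: B_def)
  have pow: "0 \<le> mat_pow S B m i j" if "i \<in> S" for m i
    using that by (induction m arbitrary: i) (auto simp: mat_mult_def mat_id_def S intro!: sum_nonneg mult_nonneg_nonneg B)
  \<comment> \<open>Killing at rate \<open>q\<close> undoes the shift from \<open>A\<close> to
    \<open>B\<close>, so the source is zero and the interpolation is constant; its values at
    \<open>0\<close> and \<open>t\<close> give the factorization.\<close>
  have D: "((\<lambda>s. exp (- q * s) * (\<Sum>k\<in>S. mexp S B s i k * mexp S A (t - s) k j)) has_real_derivative
      - (exp (- q * s) * (\<Sum>k\<in>S. mexp S B s i k * 0))) (at s)" for s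
  proof (rule mexp_duhamel_deriv[OF S(1,2), where f = "\<lambda>k t. mexp S A t k j" and g = "\<lambda>k t. 0"])
    fix k t assume k: "k \<in> S"
    have "(\<Sum>b\<in>S. B k b * mexp S A t b j) = (\<Sum>b\<in>S. A k b * mexp S A t b j) + q * mexp S A t k j"
      using S k by (simp add: B_def distrib_right sum.distrib if_distrib[of "\<lambda>x. x * _"] cong: if_cong)
    then show "((\<lambda>t. mexp S A t k j) has_real_derivative
        (\<Sum>b\<in>S. B k b * mexp S A t b j) - q * mexp S A t k j + 0) (at t)"
      using mexp_deriv_left[OF S(1) k S(3)] by simp
  qed
  then have "\<forall>s. ((\<lambda>s. exp (- q * s) * (\<Sum>k\<in>S. mexp S B s i k * mexp S A (t - s) k j)) has_real_derivative 0) (at s)"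
    by simp
  from DERIV_isconst_all[OF this, of 0 t]
  have "mexp S A t i j = exp (- q * t) * mexp S B t i j"
    using S by (simp add: mexp_0 mexp_mat_id_sum)
  moreover have "0 \<le> mexp S B t i j"
    unfolding mexp_series using S \<open>0 \<le> t\<close>
    by (intro suminf_nonneg summable_mexp) (auto intro!: mult_nonneg_nonneg divide_nonneg_nonneg pow)
  ultimately show ?thesis by simp
qed

lemma mexp_continuous:
  assumes "finite S" "i \<in> S" "j \<in> S"
  shows "continuous_on UNIV (\<lambda>t. mexp S A t i j)"
  using mexp_deriv_left[OF assms] by (intro continuous_at_imp_continuous_on ballI) (blast intro: DERIV_isCont)

lemma mexp_measurable:
  assumes "finite S" "i \<in> S" "j \<in> S"
  shows "(\<lambda>t. mexp S A t i j) \<in> borel_measurable borel"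
  using mexp_continuous[OF assms] by (rule borel_measurable_continuous_onI)

section \<open>Mixing over exponential holding times\<close>

text \<open>The list records waiting times rather than absolute times, so its tail is again an
  observation list after a restart. The value is the product of transition entries from state
  \<open>i\<close> at time \<open>a\<close> through the listed states.\<close>

primrec path_prob :: "(real \<Rightarrow> real \<Rightarrow> 's mat) \<Rightarrow> real \<Rightarrow> 's \<Rightarrow> (real \<times> 's) list \<Rightarrow> real" where
  "path_prob P a i [] = 1"
| "path_prob P a i (x # xs) = P a (a + fst x) i (snd x) * path_prob P (a + fst x) (snd x) xs"

text \<open>Here u k is the length of the k-th piece, so psums u gives the switching times; l pieces have
  already elapsed, m more are to follow before the last one, and the times a and b are measured from
  the start of the (l+1)-th piece.\<close>
primrec hold_trans ::
  "(nat \<Rightarrow> 'e mat) \<Rightarrow> nat \<Rightarrow> nat \<Rightarrow> (nat \<Rightarrow> real) \<Rightarrow> real \<Rightarrow> real \<Rightarrow> 'e mat" where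
  "hold_trans G 0 l u a b = mexp UNIV (G (Suc l)) (b - a)"
| "hold_trans G (Suc m) l u a b =
     mat_mult UNIV (mexp UNIV (G (Suc l)) (min b (u (Suc l)) - min a (u (Suc l))))
       (hold_trans G m (Suc l) u (max 0 (a - u (Suc l))) (max 0 (b - u (Suc l))))"

abbreviation aug_trans :: "nat \<Rightarrow> (nat \<Rightarrow> 'e mat) \<Rightarrow> (nat \<Rightarrow> real) \<Rightarrow> real \<Rightarrow> (nat \<times> 'e) mat" where
  "aug_trans n G q t \<equiv> mexp ({0..n} \<times> UNIV) (aug_gen n G q) t"

text \<open>Only second components are observed; the level at each observation time is summed
  out.\<close>

primrec aug_path_prob ::
  "nat \<Rightarrow> (nat \<Rightarrow> 'e mat) \<Rightarrow> (nat \<Rightarrow> real) \<Rightarrow> nat \<Rightarrow> 'e \<Rightarrow> (real \<times> 'e) list \<Rightarrow> real" where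
  "aug_path_prob n G q l i [] = 1"
| "aug_path_prob n G q l i (x # xs) =
     (\<Sum>l'\<in>{0..n}. aug_trans n G q (fst x) (l, i) (l', snd x) * aug_path_prob n G q l' (snd x) xs)"

section \<open>Transition matrices as functions of the piece lengths\<close>

lemma mat_mult_assoc: "mat_mult S (mat_mult S A B) C = mat_mult S A (mat_mult S B C)"
  unfolding mat_mult_def sum_distrib_left sum_distrib_right
  by (intro ext) (subst sum.swap, simp add: mult.assoc)

lemma mat_mult_id:
  fixes A :: "'e::finite mat"
  shows "mat_mult UNIV mat_id A = A" "mat_mult UNIV A mat_id = A"
  by (intro ext, simp add: mat_mult_def mexp_mat_id_sum)+

text \<open>The fold multiplies the pieces from left to right, whereas \<open>hold_trans\<close>
  peels off the first remaining piece. The induction therefore carries the accumulated product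
  \<open>P\<close> and the number \<open>l\<close> of pieces already consumed; subtracting
  \<open>psums u l\<close> and cutting at 0 moves the clock to the start of piece
  \<open>Suc l\<close>.\<close>

lemma fold_piece_len:
  fixes G :: "nat \<Rightarrow> 'e::finite mat"
  assumes "u \<in> pos_orthant (l + m)" "0 \<le> a" "a \<le> b"
  shows "fold (\<lambda>k P. mat_mult UNIV P (mexp UNIV (G k) (piece_len (l + m) (psums u) k a b))) [Suc l..<l + m + 2] P
    = mat_mult UNIV P (hold_trans G m l u (max 0 (a - psums u l)) (max 0 (b - psums u l)))"
  using assms(1)
proof (induction m arbitrary: l P)
  case 0
  have "piece_len l (psums u) (Suc l) a b = max 0 (b - psums u l) - max 0 (a - psums u l)"
    using \<open>0 \<le> a\<close> \<open>a \<le> b\<close> by (cases l) (auto simp: piece_len_def psums_def Let_def)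
  then show ?case by simp
next
  case (Suc m)
  have u: "0 < u (Suc l)" using Suc.prems by (auto simp: pos_orthant_def)
  have S: "psums u (Suc l) = psums u l + u (Suc l)" by (simp add: psums_def)
  have lo: "(if Suc l = 1 then 0 else psums u (Suc l - 1)) = psums u l"
    by (auto simp: psums_def)
  have piece: "piece_len (l + Suc m) (psums u) (Suc l) a b
      = min (max 0 (b - psums u l)) (u (Suc l)) - min (max 0 (a - psums u l)) (u (Suc l))"
    using \<open>0 \<le> a\<close> \<open>a \<le> b\<close> u unfolding piece_len_def lo S Let_def by auto
  have max: "max 0 (max 0 (x - psums u l) - u (Suc l)) = max 0 (x - psums u (Suc l))" for x
    using u by (auto simp: S)
  have "[Suc l..<l + Suc m + 2] = Suc l # [Suc (Suc l)..<Suc l + m + 2]"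
    by (simp add: upt_conv_Cons)
  then show ?case
    using Suc.IH[of "Suc l" "mat_mult UNIV P (mexp UNIV (G (Suc l)) (piece_len (l + Suc m) (psums u) (Suc l) a b))"] Suc.prems piece
    by (simp add: max mat_mult_assoc)
qed

lemma pw_trans_eq_hold_trans:
  fixes G :: "nat \<Rightarrow> 'e::finite mat"
  assumes "u \<in> pos_orthant n" "0 \<le> a" "a \<le> b"
  shows "pw_trans UNIV G n (psums u) a b = hold_trans G n 0 u a b"
  using fold_piece_len[of u 0 n a b G mat_id] assms
  by (simp add: pw_trans_def mat_mult_id psums_def[of u])

lemma incr_times_psums:
  assumes "u \<in> pos_orthant n"
  shows "incr_times n (psums u)"
  using assms by (auto simp: incr_times_def pos_orthant_def psums_def)

lemma hold_trans_cong:
  assumes "\<And>k. l < k \<Longrightarrow> k \<le> l + m \<Longrightarrow> u k = w k"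
  shows "hold_trans G m l u a b = hold_trans G m l w a b"
  using assms
proof (induction m arbitrary: l a b)
  case (Suc m)
  have "hold_trans G m (Suc l) u = hold_trans G m (Suc l) w"
    using Suc.prems by (intro ext Suc.IH) auto
  then show ?case using Suc.prems[of "Suc l"] by simp
qed simp

lemma hold_trans_refl:
  fixes G :: "nat \<Rightarrow> 'e::finite mat"
  shows "hold_trans G m l u a a = mat_id"
  by (induction m arbitrary: l a) (simp_all add: mexp_0 mat_mult_id)

lemma hold_trans_after:
  fixes G :: "nat \<Rightarrow> 'e::finite mat"
  assumes "u (Suc l) \<le> a" "a \<le> b"
  shows "hold_trans G (Suc m) l u a b = hold_trans G m (Suc l) u (a - u (Suc l)) (b - u (Suc l))"
  using assms by (simp add: mexp_0 mat_mult_id min_absorb2)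

text \<open>Only times relative to the end of the current piece matter. Moving the clock forward
  within that piece thus amounts to shortening it, the deterministic counterpart of the lack of
  memory of its length.\<close>

lemma hold_trans_shift:
  "hold_trans G (Suc m) l (u(Suc l := y + h)) (a + h) (b + h) = hold_trans G (Suc m) l (u(Suc l := y)) a b"
proof -
  have "hold_trans G m (Suc l) (u(Suc l := y + h)) = hold_trans G m (Suc l) (u(Suc l := y))"
    by (intro ext hold_trans_cong) auto
  moreover have "min (b + h) (y + h) - min (a + h) (y + h) = min b y - min a y"
    by (auto simp: min_def)
  ultimately show ?thesis by simp
qed

text \<open>The bound \<open>c\<close> restricts the comparison of \<open>P\<close> and
  \<open>Q\<close> to the times actually visited. With \<open>h = 0\<close> it compares two
  transition families without any shift.\<close>

lemma path_prob_shift: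
  assumes "\<And>a b i j. c \<le> a \<Longrightarrow> a \<le> b \<Longrightarrow> P (a + h) (b + h) i j = Q a b i j" "c \<le> a" "\<forall>x\<in>set xs. 0 \<le> fst x"
  shows "path_prob P (a + h) i xs = path_prob Q a i xs"
  using assms(2,3)
proof (induction xs arbitrary: a i)
  case (Cons x xs)
  have "path_prob P ((a + fst x) + h) (snd x) xs = path_prob Q (a + fst x) (snd x) xs"
    using Cons by auto
  then show ?case
    using assms(1)[of a "a + fst x" i "snd x"] Cons.prems by (simp add: add_ac)
qed simp

lemma path_prob_nonneg:
  assumes "\<And>a b i j. a \<le> b \<Longrightarrow> 0 \<le> P a b i j" "\<forall>x\<in>set xs. 0 \<le> fst x"
  shows "0 \<le> path_prob P a i xs"
  using assms(2) by (induction xs arbitrary: a i) (auto intro!: mult_nonneg_nonneg assms(1))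

lemma hold_trans_nonneg:
  fixes G :: "nat \<Rightarrow> 'e::finite mat"
  assumes "\<And>k. l < k \<Longrightarrow> k \<le> Suc (l + m) \<Longrightarrow> is_generator UNIV (G k)" "a \<le> b"
  shows "0 \<le> hold_trans G m l u a b i j"
  using assms
proof (induction m arbitrary: l a b i)
  case 0
  then show ?case by (auto simp: is_generator_def intro!: mexp_nonneg)
next
  case (Suc m)
  have "0 \<le> mexp UNIV (G (Suc l)) (min b (u (Suc l)) - min a (u (Suc l))) i k" for k
    using Suc.prems by (intro mexp_nonneg) (auto simp: is_generator_def)
  moreover have "0 \<le> hold_trans G m (Suc l) u (max 0 (a - u (Suc l))) (max 0 (b - u (Suc l))) k j" for k
    using Suc.prems by (intro Suc.IH) auto
  ultimately show ?case by (auto simp: mat_mult_def intro!: sum_nonneg)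
qed

text \<open>The time bounds must be allowed to vary with \<open>x\<close>, because the recursion
  feeds them with the length of the elapsed piece.\<close>

lemma hold_trans_measurable:
  fixes G :: "nat \<Rightarrow> 'e::finite mat"
  assumes "\<And>k. l < k \<Longrightarrow> k \<le> l + m \<Longrightarrow> (\<lambda>x. u x k) \<in> borel_measurable N"
    and "a \<in> borel_measurable N" "b \<in> borel_measurable N"
  shows "(\<lambda>x. hold_trans G m l (u x) (a x) (b x) i j) \<in> borel_measurable N"
  using assms
proof (induction m arbitrary: l a b i)
  case 0
  note [measurable] = 0(2,3)
  show ?case
    by (simp, rule measurable_compose[OF _ mexp_measurable]) auto
next
  case (Suc m)
  note [measurable] = Suc.prems(2,3)
  have [measurable]: "(\<lambda>x. u x (Suc l)) \<in> borel_measurable N" by (rule Suc.prems) auto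
  have [measurable]: "(\<lambda>x. hold_trans G m (Suc l) (u x) (max 0 (a x - u x (Suc l)))
      (max 0 (b x - u x (Suc l))) k j) \<in> borel_measurable N" for k
    by (rule Suc.IH) (auto intro: Suc.prems(1))
  have [measurable]: "(\<lambda>x. mexp UNIV (G (Suc l)) (min (b x) (u x (Suc l)) - min (a x) (u x (Suc l))) i k)
      \<in> borel_measurable N" for k
    by (rule measurable_compose[OF _ mexp_measurable]) auto
  show ?case unfolding hold_trans.simps mat_mult_def by measurable
qed

lemma path_prob_measurable:
  assumes "\<And>a b i j. (\<lambda>x. P x a b i j) \<in> borel_measurable N"
  shows "(\<lambda>x. path_prob (P x) a i xs) \<in> borel_measurable N"
  by (induction xs arbitrary: a i) (auto intro!: borel_measurable_times assms)

section \<open>First-jump equation of the augmented chain\<close>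

text \<open>A row meets only its own level and the next one. At level \<open>n\<close> the
  coefficient \<open>r\<close> is 0, which removes \<open>F (Suc n, a)\<close>, a value outside the
  state space.\<close>

lemma aug_gen_row_sum:
  fixes G :: "nat \<Rightarrow> 'e::finite mat" and q :: "nat \<Rightarrow> real"
  assumes "l \<le> n"
  defines "r \<equiv> if l < n then q (Suc l) else 0"
  shows "(\<Sum>k\<in>{0..n} \<times> UNIV. aug_gen n G q (l, a) k * F k)
    = (\<Sum>b\<in>UNIV. G (Suc l) a b * F (l, b)) - r * F (l, a) + r * F (Suc l, a)"
proof -
  have row: "aug_gen n G q (l, a) (l', b)
      = (if l' = l then G (Suc l) a b - mat_id a b * r else 0) + (if l' = Suc l then mat_id a b * r else 0)" for l' b
    using assms by (auto simp: aug_gen_def mat_id_def)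
  have "(\<Sum>k\<in>{0..n} \<times> UNIV. aug_gen n G q (l, a) k * F k)
      = (\<Sum>l'\<in>{0..n}. \<Sum>b\<in>UNIV. aug_gen n G q (l, a) (l', b) * F (l', b))"
    by (simp add: sum.cartesian_product case_prod_unfold)
  also have "\<dots> = (\<Sum>l'\<in>{0..n}. (if l' = l then (\<Sum>b\<in>UNIV. (G (Suc l) a b - mat_id a b * r) * F (l, b)) else 0)
      + (if l' = Suc l then (\<Sum>b\<in>UNIV. mat_id a b * (r * F (Suc l, b))) else 0))"
    by (intro sum.cong refl) (auto simp: row mult.assoc)
  also have "\<dots> = (\<Sum>b\<in>UNIV. (G (Suc l) a b - mat_id a b * r) * F (l, b)) + r * F (Suc l, a)"
    using assms by (auto simp: sum.distrib mexp_mat_id_sum)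
  also have "(\<Sum>b\<in>UNIV. (G (Suc l) a b - mat_id a b * r) * F (l, b))
      = (\<Sum>b\<in>UNIV. G (Suc l) a b * F (l, b)) - (\<Sum>b\<in>UNIV. mat_id a b * (r * F (l, b)))"
    by (simp add: left_diff_distrib sum_subtractf mult.assoc)
  finally show ?thesis by (simp add: mexp_mat_id_sum)
qed

locale holding_rates =
  fixes n :: nat and G :: "nat \<Rightarrow> 'e::finite mat" and q :: "nat \<Rightarrow> real"
  assumes gen: "k \<in> {1..n+1} \<Longrightarrow> is_generator UNIV (G k)"
    and q_pos: "k \<in> {1..n} \<Longrightarrow> 0 < q k"
begin

abbreviation "V \<equiv> aug_path_prob n G q"

lemma G_nonneg: "l \<le> n \<Longrightarrow> i \<noteq> j \<Longrightarrow> 0 \<le> G (Suc l) i j"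
  using gen[of "Suc l"] by (auto simp: is_generator_def)

lemma mexp_G_nonneg: "l \<le> n \<Longrightarrow> 0 \<le> t \<Longrightarrow> 0 \<le> mexp UNIV (G (Suc l)) t i j"
  by (intro mexp_nonneg) (auto intro: G_nonneg)

lemma aug_trans_nonneg:
  assumes "0 \<le> t" "l \<le> n" "l' \<le> n"
  shows "0 \<le> aug_trans n G q t (l, i) (l', j)"
proof (rule mexp_nonneg)
  fix x y :: "nat \<times> 'e" assume "x \<in> {0..n} \<times> UNIV" "y \<in> {0..n} \<times> UNIV" "x \<noteq> y"
  moreover obtain a b a' b' where "x = (a, b)" "y = (a', b')" by (meson surj_pair)
  ultimately show "0 \<le> aug_gen n G q x y"
    using G_nonneg[of a b b'] G_nonneg[of n b b'] q_pos[of "Suc a"] by (auto simp: aug_gen_def)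
qed (use assms in auto)

lemma V_nonneg: "l \<le> n \<Longrightarrow> \<forall>x\<in>set xs. 0 \<le> fst x \<Longrightarrow> 0 \<le> V l i xs"
  by (induction xs arbitrary: l i) (auto intro!: sum_nonneg mult_nonneg_nonneg aug_trans_nonneg)

text \<open>The value 0 at the absorbing level \<open>n\<close> lets all equations below be stated
  uniformly: \<open>V (Suc n)\<close> always appears multiplied by 0.\<close>

definition rate :: "nat \<Rightarrow> real" where "rate l = (if l < n then q (Suc l) else 0)"

lemma rate_nonneg: "0 \<le> rate l"
  using q_pos[of "Suc l"] by (auto simp: rate_def)

text \<open>The backward equation of the augmented chain, in the length of the first observation
  interval. The later observations enter only through coefficients \<open>V l' j xs\<close>
  independent of \<open>t\<close>, so it passes from the transition entries to \<open>V\<close> by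
  linearity. Jumps to the next level form the source term.\<close>

lemma V_deriv:
  assumes "l \<le> n"
  shows "((\<lambda>t. V l a ((t, j) # xs)) has_real_derivative
    (\<Sum>b\<in>UNIV. G (Suc l) a b * V l b ((t, j) # xs)) - rate l * V l a ((t, j) # xs)
      + rate l * V (Suc l) a ((t, j) # xs)) (at t)"
proof -
  have "((\<lambda>t. aug_trans n G q t (l, a) (l', j)) has_real_derivative
      (\<Sum>b\<in>UNIV. G (Suc l) a b * aug_trans n G q t (l, b) (l', j)) - rate l * aug_trans n G q t (l, a) (l', j)
      + rate l * aug_trans n G q t (Suc l, a) (l', j)) (at t)" if "l' \<in> {0..n}" for l'
    using mexp_deriv_left[of "{0..n} \<times> UNIV" "(l, a)" "(l', j)" "aug_gen n G q" t] assms that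
    by (simp add: aug_gen_row_sum rate_def)
  then have "((\<lambda>t. \<Sum>l'\<in>{0..n}. aug_trans n G q t (l, a) (l', j) * V l' j xs) has_real_derivative
     (\<Sum>l'\<in>{0..n}. ((\<Sum>b\<in>UNIV. G (Suc l) a b * aug_trans n G q t (l, b) (l', j))
      - rate l * aug_trans n G q t (l, a) (l', j)
      + rate l * aug_trans n G q t (Suc l, a) (l', j)) * V l' j xs)) (at t)"
    by (intro DERIV_sum DERIV_cmult_right) auto
  moreover have "(\<Sum>l'\<in>{0..n}. ((\<Sum>b\<in>UNIV. G (Suc l) a b * aug_trans n G q t (l, b) (l', j))
      - rate l * aug_trans n G q t (l, a) (l', j)
      + rate l * aug_trans n G q t (Suc l, a) (l', j)) * V l' j xs)
    = (\<Sum>b\<in>UNIV. G (Suc l) a b * V l b ((t, j) # xs)) - rate l * V l a ((t, j) # xs)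
      + rate l * V (Suc l) a ((t, j) # xs)"
  proof -
    have "(\<Sum>b\<in>UNIV. G (Suc l) a b * V l b ((t, j) # xs))
      = (\<Sum>l'\<in>{0..n}. (\<Sum>b\<in>UNIV. G (Suc l) a b * aug_trans n G q t (l, b) (l', j)) * V l' j xs)"
      by (simp add: sum_distrib_left sum_distrib_right mult.assoc) (rule sum.swap)
    then show ?thesis
      by (simp add: sum.distrib sum_subtractf sum_distrib_left algebra_simps)
  qed
  ultimately show ?thesis by simp
qed

text \<open>The Duhamel derivative integrated over \<open>{0..d}\<close>. In the integral,
  \<open>s\<close> is the time of the level change and \<open>k\<close> the state then; the last
  term is the case of no level change before \<open>d\<close>.\<close>

lemma V_first_jump:
  assumes l: "l \<le> n" and d: "0 \<le> d" and xs: "\<forall>x\<in>set xs. 0 \<le> fst x"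
  shows "ennreal (V l i ((d, j) # xs)) =
    (\<integral>\<^sup>+s. ennreal (exp (- rate l * s) * (\<Sum>k\<in>UNIV. mexp UNIV (G (Suc l)) s i k *
        (rate l * V (Suc l) k ((d - s, j) # xs)))) * indicator {0..d} s \<partial>lborel)
    + ennreal (exp (- rate l * d) * mexp UNIV (G (Suc l)) d i j * V l j xs)"
proof -
  \<comment> \<open>The sign makes the derivative non-negative, as the fundamental theorem for
    non-negative integrals requires.\<close>
  let ?F = "\<lambda>s. - (exp (- rate l * s) * (\<Sum>k\<in>UNIV. mexp UNIV (G (Suc l)) s i k * V l k ((d - s, j) # xs)))"
  let ?f = "\<lambda>s. exp (- rate l * s) * (\<Sum>k\<in>UNIV. mexp UNIV (G (Suc l)) s i k *
        (rate l * V (Suc l) k ((d - s, j) # xs)))"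
  have D: "(?F has_real_derivative ?f s) (at s)" for s
    using DERIV_minus[OF mexp_duhamel_deriv[of UNIV i "\<lambda>k t. V l k ((t, j) # xs)" "G (Suc l)" "rate l"
        "\<lambda>k t. rate l * V (Suc l) k ((t, j) # xs)", OF _ _ V_deriv[OF l]]]
    by simp
  have f0: "0 \<le> ?f s" if "0 \<le> s" "s \<le> d" for s
  proof (cases "l < n")
    case True
    then show ?thesis using that l xs
      by (intro mult_nonneg_nonneg sum_nonneg mexp_G_nonneg rate_nonneg V_nonneg) auto
  qed (simp add: rate_def)
  have "continuous_on UNIV (\<lambda>t. V k a ((t, j) # xs))" if "k \<le> n" for k a
    using V_deriv[OF that] by (intro continuous_at_imp_continuous_on ballI) (blast intro: DERIV_isCont)
  then have [measurable]: "(\<lambda>t. V k a ((t, j) # xs)) \<in> borel_measurable borel" if "k \<le> n" for k a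
    using that by (intro borel_measurable_continuous_onI)
  have [measurable]: "(\<lambda>s. rate l * V (Suc l) k ((d - s, j) # xs)) \<in> borel_measurable borel" for k
  proof (cases "l < n")
    case True
    have "(\<lambda>s. V (Suc l) k ((d - s, j) # xs)) \<in> borel_measurable borel"
      using True by (intro measurable_compose[of "\<lambda>s. d - s" borel borel "\<lambda>t. V (Suc l) k ((t, j) # xs)"])
        (auto simp del: aug_path_prob.simps)
    then show ?thesis by (rule borel_measurable_times[OF borel_measurable_const])
  qed (simp add: rate_def)
  have [measurable]: "(\<lambda>s. mexp UNIV (G (Suc l)) s i k) \<in> borel_measurable borel" for k
    by (rule mexp_measurable) auto
  have "?f \<in> borel_measurable borel" by measurable
  then have "(\<integral>\<^sup>+s. ennreal (?f s) * indicator {0..d} s \<partial>lborel) = ennreal (?F d - ?F 0)"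
    by (rule nn_integral_FTC_Icc[OF _ has_field_derivative_at_within[OF D] f0 d]) auto
  moreover have "?F 0 \<le> ?F d"
    using D f0 by (intro DERIV_nonneg_imp_nondecreasing[OF d]) blast
  moreover have "?F 0 = - V l i ((d, j) # xs)"
    by (simp add: mexp_0 mexp_mat_id_sum del: aug_path_prob.simps)
  moreover have "?F d = - (exp (- rate l * d) * mexp UNIV (G (Suc l)) d i j * V l j xs)"
  proof -
    \<comment> \<open>At \<open>s = d\<close> no time is left before the observation, the transition
      matrix is the identity, and only the unchanged level \<open>l\<close> survives in the
      sum.\<close>
    have "V l k ((0, j) # xs) = mat_id k j * V l j xs" for k
    proof -
      have "V l k ((0, j) # xs) = (\<Sum>l'\<in>{0..n}. if l' = l then mat_id k j * V l j xs else 0)"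
        unfolding aug_path_prob.simps by (rule sum.cong) (auto simp: mexp_0 mat_id_def)
      then show ?thesis using l by simp
    qed
    then show ?thesis
      by (simp add: mult.assoc flip: sum_distrib_right del: aug_path_prob.simps)
         (simp add: sum_distrib_right[symmetric] mult.assoc[symmetric] mexp_mat_id_sum)
  qed
  moreover have "0 \<le> exp (- rate l * d) * mexp UNIV (G (Suc l)) d i j * V l j xs"
    using l d xs by (intro mult_nonneg_nonneg mexp_G_nonneg V_nonneg) auto
  ultimately show ?thesis
    by (simp flip: ennreal_plus del: aug_path_prob.simps)
qed

section \<open>Averages over independent exponential piece lengths\<close>

text \<open>The exponential density of rate \<open>q k\<close>, cut off on the open half-line so
  that the product of these densities vanishes off \<open>pos_orthant n\<close>.\<close>

definition hold_density :: "nat \<Rightarrow> real \<Rightarrow> ennreal" where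
  "hold_density k x = ennreal (q k * exp (- (q k * x))) * indicator {0<..} x"

definition hold_integral :: "nat \<Rightarrow> nat \<Rightarrow> ((nat \<Rightarrow> real) \<Rightarrow> ennreal) \<Rightarrow> ennreal" where
  "hold_integral m l f =
    (\<integral>\<^sup>+u. (\<Prod>k\<in>{Suc l..l + m}. hold_density k (u k)) * f u \<partial>PiM {Suc l..l + m} (\<lambda>_. lborel))"

lemma hold_density_measurable[measurable]: "hold_density k \<in> borel_measurable borel"
  unfolding hold_density_def by measurable

lemma nn_integral_hold_density:
  assumes "k \<in> {1..n}"
  shows "(\<integral>\<^sup>+x. hold_density k x \<partial>lborel) = 1"
proof -
  have q: "0 < q k" using assms by (rule q_pos)
  have "(\<integral>\<^sup>+x. hold_density k x \<partial>lborel)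
      = (\<integral>\<^sup>+x. ennreal (q k * exp (- (q k * x))) * indicator {0..} x \<partial>lborel)"
    by (rule nn_integral_cong_AE)
       (use AE_lborel_singleton[of "0::real"] in eventually_elim, auto simp: hold_density_def split: split_indicator)
  also have "\<dots> = ennreal (0 - (- exp (- (q k * 0))))"
  proof (rule nn_integral_FTC_atLeast)
    show "((\<lambda>x. - exp (- (q k * x))) \<longlongrightarrow> 0) at_top"
      using q by real_asymp
  qed (use q in \<open>auto intro!: derivative_eq_intros mult_nonneg_nonneg\<close>)
  finally show ?thesis by simp
qed

lemma hold_integral_cmult:
  assumes [measurable]: "f \<in> borel_measurable (PiM {Suc l..l + m} (\<lambda>_. lborel))"
  shows "hold_integral m l (\<lambda>u. c * f u) = c * hold_integral m l f"
proof -
  have "(\<lambda>u. (\<Prod>k\<in>{Suc l..l + m}. hold_density k (u k)) * f u) \<in> borel_measurable (PiM {Suc l..l + m} (\<lambda>_. lborel))"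
    by measurable
  from nn_integral_cmult[OF this, of c] show ?thesis
    by (simp only: hold_integral_def mult.left_commute)
qed

lemma hold_integral_sum:
  assumes [measurable]: "\<And>k. k \<in> A \<Longrightarrow> f k \<in> borel_measurable (PiM {Suc l..l + m} (\<lambda>_. lborel))"
  shows "hold_integral m l (\<lambda>u. \<Sum>k\<in>A. f k u) = (\<Sum>k\<in>A. hold_integral m l (f k))"
  unfolding hold_integral_def sum_distrib_left by (intro nn_integral_sum) measurable

text \<open>Tonelli with the first length outermost, since that length alone decides whether the
  first observation precedes the first switch.\<close>

lemma hold_integral_Suc:
  assumes [measurable]: "f \<in> borel_measurable (PiM {Suc l..l + Suc m} (\<lambda>_. lborel))"
  shows "hold_integral (Suc m) l f =
    (\<integral>\<^sup>+x. hold_density (Suc l) x * hold_integral m (Suc l) (\<lambda>u. f (u(Suc l := x))) \<partial>lborel)"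
proof -
  interpret product_sigma_finite "\<lambda>_::nat. lborel :: real measure"
    by standard
  let ?I = "{Suc (Suc l)..Suc l + m}"
  have I: "{Suc l..l + Suc m} = insert (Suc l) ?I" by auto
  have [measurable]: "f \<in> borel_measurable (PiM (insert (Suc l) ?I) (\<lambda>_. lborel))"
    using assms unfolding I .
  let ?g = "\<lambda>u. (\<Prod>k\<in>insert (Suc l) ?I. hold_density k (u k)) * f u"
  have "?g \<in> borel_measurable (PiM (insert (Suc l) ?I) (\<lambda>_. lborel))"
    by measurable
  then have "hold_integral (Suc m) l f = (\<integral>\<^sup>+x. (\<integral>\<^sup>+u. ?g (u(Suc l := x)) \<partial>PiM ?I (\<lambda>_. lborel)) \<partial>lborel)"
    unfolding hold_integral_def I by (intro product_nn_integral_insert_rev) auto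
  also have "\<dots> = (\<integral>\<^sup>+x. hold_density (Suc l) x * hold_integral m (Suc l) (\<lambda>u. f (u(Suc l := x))) \<partial>lborel)"
  proof (rule nn_integral_cong)
    fix x :: real
    have upd: "(\<lambda>u. u(Suc l := x)) \<in> PiM ?I (\<lambda>_. lborel) \<rightarrow>\<^sub>M PiM (insert (Suc l) ?I) (\<lambda>_. lborel)"
      by (rule measurable_fun_upd[where J = ?I]) auto
    have [measurable]: "(\<lambda>u. f (u(Suc l := x))) \<in> borel_measurable (PiM ?I (\<lambda>_. lborel))"
      by (rule measurable_compose[OF upd]) measurable
    have "(\<Prod>k\<in>insert (Suc l) ?I. hold_density k ((u(Suc l := x)) k))
        = hold_density (Suc l) x * (\<Prod>k\<in>?I. hold_density k (u k))" for u
    proof -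
      have "(\<Prod>k\<in>?I. hold_density k ((u(Suc l := x)) k)) = (\<Prod>k\<in>?I. hold_density k (u k))"
        by (intro prod.cong) auto
      then show ?thesis by (subst prod.insert) auto
    qed
    moreover have "(\<lambda>u. (\<Prod>k\<in>?I. hold_density k (u k)) * f (u(Suc l := x)))
        \<in> borel_measurable (PiM ?I (\<lambda>_. lborel))"
      by measurable
    ultimately show "(\<integral>\<^sup>+u. ?g (u(Suc l := x)) \<partial>PiM ?I (\<lambda>_. lborel))
        = hold_density (Suc l) x * hold_integral m (Suc l) (\<lambda>u. f (u(Suc l := x)))"
      unfolding hold_integral_def by (subst nn_integral_cmult[symmetric]) (simp_all only: mult.assoc)
  qed
  finally show ?thesis .
qed

lemma path_prob_hold_trans_measurable:
  assumes "\<And>k. l < k \<Longrightarrow> k \<le> l + m \<Longrightarrow> (\<lambda>x. u x k) \<in> borel_measurable N"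
  shows "(\<lambda>x. path_prob (hold_trans G m l (u x)) a i xs) \<in> borel_measurable N"
  by (intro path_prob_measurable hold_trans_measurable assms) auto

lemma path_prob_hold_nonneg:
  assumes "l + m = n" "\<forall>x\<in>set xs. 0 \<le> fst x"
  shows "0 \<le> path_prob (hold_trans G m l u) a i xs"
  using assms by (intro path_prob_nonneg hold_trans_nonneg gen) auto

text \<open>The switch falls into the first observation interval: splitting it at \<open>x\<close>
  over the state \<open>k\<close> at the switch leaves a chain with one piece fewer and first
  waiting time \<open>d - x\<close>.\<close>

lemma path_prob_jump:
  assumes "0 < x" "x \<le> d" "\<forall>y\<in>set xs. 0 \<le> fst y"
  shows "path_prob (hold_trans G (Suc m) l (u(Suc l := x))) 0 i ((d, j) # xs) =
    (\<Sum>k\<in>UNIV. mexp UNIV (G (Suc l)) x i k * path_prob (hold_trans G m (Suc l) u) 0 k ((d - x, j) # xs))"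
proof -
  let ?u = "u(Suc l := x)"
  have u: "hold_trans G m (Suc l) ?u = hold_trans G m (Suc l) u"
    by (intro ext hold_trans_cong) auto
  have "path_prob (hold_trans G (Suc m) l ?u) ((d - x) + x) j xs = path_prob (hold_trans G m (Suc l) u) (d - x) j xs"
    by (rule path_prob_shift[where c = 0])
       (use assms in \<open>auto simp del: hold_trans.simps simp: hold_trans_after u\<close>)
  then show ?thesis using assms
    by (simp add: u mat_mult_def sum_distrib_right mult.assoc min_absorb2 min_absorb1)
qed

text \<open>The first piece outlasts the first observation, so the chain restarts at time
  \<open>d\<close> with residual length \<open>x - d\<close>.\<close>

lemma path_prob_no_jump:
  assumes "0 \<le> d" "d < x" "\<forall>y\<in>set xs. 0 \<le> fst y"
  shows "path_prob (hold_trans G (Suc m) l (u(Suc l := x))) 0 i ((d, j) # xs) =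
    mexp UNIV (G (Suc l)) d i j * path_prob (hold_trans G (Suc m) l (u(Suc l := x - d))) 0 j xs"
proof -
  have "path_prob (hold_trans G (Suc m) l (u(Suc l := x))) (0 + d) j xs
      = path_prob (hold_trans G (Suc m) l (u(Suc l := x - d))) 0 j xs"
    by (rule path_prob_shift[where c = 0])
       (use assms hold_trans_shift[of G m l u "x - d" d] in \<open>auto simp del: hold_trans.simps\<close>)
  then show ?thesis using assms
    by (simp add: hold_trans_refl mat_mult_id min_absorb1 del: hold_trans.simps(2))
       (simp add: hold_trans_refl mat_mult_id min_absorb1)
qed

text \<open>A level change in the first observation interval reduces to one level fewer, none in it to one
  observation fewer; hence the nested induction.\<close>
lemma hold_integral_path_prob:
  assumes "l + m = n" "\<forall>x\<in>set xs. 0 \<le> fst x"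
  shows "hold_integral m l (\<lambda>u. ennreal (path_prob (hold_trans G m l u) 0 i xs)) = ennreal (V l i xs)"
  using assms
proof (induction m arbitrary: l i xs)
  case 0
  \<comment> \<open>At the last level the rate is 0, so the renewal equation reduces to its last
    term and \<open>V\<close> becomes a product of entries of a homogeneous chain. The integral is
    over an empty product, a point mass, and averages nothing.\<close>
  have "path_prob (hold_trans G 0 n u) a i xs = V n i xs" for u a
    using 0(2)
  proof (induction xs arbitrary: a i)
    case (Cons x xs)
    have "V n i ((fst x, snd x) # xs) = mexp UNIV (G (Suc n)) (fst x) i (snd x) * V n (snd x) xs"
      using V_first_jump[of n "fst x" xs i "snd x"] Cons.prems
      by (subst ennreal_inj[symmetric])
         (auto simp: rate_def simp del: aug_path_prob.simps intro!: mult_nonneg_nonneg mexp_G_nonneg V_nonneg)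
    then show ?case using Cons by (simp del: aug_path_prob.simps)
  qed simp
  then show ?case
    using 0 by (simp add: hold_integral_def PiM_empty nn_integral_count_space_finite del: hold_trans.simps)
next
  case (Suc m)
  \<comment> \<open>The average over the later lengths when the first length is fixed to
    \<open>x\<close>.\<close>
  define I where "I x i xs =
    hold_integral m (Suc l) (\<lambda>u. ennreal (path_prob (hold_trans G (Suc m) l (u(Suc l := x))) 0 i xs))" for x i xs
  have l: "l < n" "Suc l + m = n" "Suc l \<in> {1..n}" using Suc.prems by auto
  interpret product_sigma_finite "\<lambda>_::nat. lborel :: real measure"
    by standard
  interpret S: sigma_finite_measure "PiM {Suc (Suc l)..Suc l + m} (\<lambda>_. lborel :: real measure)"
    by (rule sigma_finite) auto
  have [measurable]: "(\<lambda>x. I x i xs) \<in> borel_measurable borel" for i xs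
  proof -
    have [measurable]: "(\<lambda>(x, u). path_prob (hold_trans G (Suc m) l (u(Suc l := x))) 0 i xs)
        \<in> borel_measurable (borel \<Otimes>\<^sub>M PiM {Suc (Suc l)..Suc l + m} (\<lambda>_. lborel))"
      unfolding case_prod_unfold
    proof (rule path_prob_hold_trans_measurable)
      fix k assume "l < k" "k \<le> l + Suc m"
      then show "(\<lambda>p. ((snd p)(Suc l := fst p)) k)
          \<in> borel_measurable (borel \<Otimes>\<^sub>M PiM {Suc (Suc l)..Suc l + m} (\<lambda>_. lborel))"
        by (cases "k = Suc l") auto
    qed
    show ?thesis
      unfolding I_def hold_integral_def by measurable
  qed
  have peel: "hold_integral (Suc m) l (\<lambda>u. ennreal (path_prob (hold_trans G (Suc m) l u) 0 i xs))
      = (\<integral>\<^sup>+x. hold_density (Suc l) x * I x i xs \<partial>lborel)" for i xs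
    unfolding I_def
    by (rule hold_integral_Suc, intro measurable_compose[OF _ measurable_ennreal] path_prob_hold_trans_measurable) auto
  show ?case
    using Suc.prems(2)
  proof (induction xs arbitrary: i)
    case Nil
    have "I x i [] = 1" for x
      using Suc.IH[OF l(2), of "[]"] by (simp add: I_def)
    then show ?case
      using nn_integral_hold_density[OF l(3)] unfolding peel by simp
  next
    case (Cons y xs)
    obtain d j where y: "y = (d, j)" by (cases y)
    have d: "0 \<le> d" and xs: "\<forall>x\<in>set xs. 0 \<le> fst x" using Cons.prems y by auto
    let ?r = "rate l" and ?A = "mexp UNIV (G (Suc l))"
    have r: "q (Suc l) = ?r" using l by (simp add: rate_def)
    have "hold_integral (Suc m) l (\<lambda>u. ennreal (path_prob (hold_trans G (Suc m) l u) 0 i (y # xs)))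
      = (\<integral>\<^sup>+x. hold_density (Suc l) x * I x i (y # xs) * indicator {..d} x
           + hold_density (Suc l) x * I x i (y # xs) * indicator {d<..} x \<partial>lborel)"
      unfolding peel by (intro nn_integral_cong) (auto split: split_indicator)
    also have "\<dots> = (\<integral>\<^sup>+x. hold_density (Suc l) x * I x i (y # xs) * indicator {..d} x \<partial>lborel)
        + (\<integral>\<^sup>+x. hold_density (Suc l) x * I x i (y # xs) * indicator {d<..} x \<partial>lborel)"
      by (rule nn_integral_add) measurable
    also have "(\<integral>\<^sup>+x. hold_density (Suc l) x * I x i (y # xs) * indicator {..d} x \<partial>lborel)
      = (\<integral>\<^sup>+s. ennreal (exp (- ?r * s) * (\<Sum>k\<in>UNIV. ?A s i k *
        (?r * V (Suc l) k ((d - s, j) # xs)))) * indicator {0..d} s \<partial>lborel)"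
    \<comment> \<open>The point 0 is discarded because the density vanishes there while the
      right-hand integrand need not.\<close>
    proof (rule nn_integral_cong_AE, use AE_lborel_singleton[of "0::real"] in eventually_elim)
      fix x :: real assume "x \<noteq> 0"
      show "hold_density (Suc l) x * I x i (y # xs) * indicator {..d} x
        = ennreal (exp (- ?r * x) * (\<Sum>k\<in>UNIV. ?A x i k *
            (?r * V (Suc l) k ((d - x, j) # xs)))) * indicator {0..d} x"
      proof (cases "0 < x \<and> x \<le> d")
        case True
        have ds: "\<forall>z\<in>set ((d - x, j) # xs). 0 \<le> fst z" using True xs by auto
        have A0: "0 \<le> ?A x i k" for k using True l by (intro mexp_G_nonneg) auto
        have P0: "0 \<le> path_prob (hold_trans G m (Suc l) u) 0 k ((d - x, j) # xs)" for u k
          by (rule path_prob_hold_nonneg[OF l(2) ds])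
        have [measurable]: "(\<lambda>u. path_prob (hold_trans G m (Suc l) u) 0 k ((d - x, j) # xs))
            \<in> borel_measurable (PiM {Suc (Suc l)..Suc l + m} (\<lambda>_. lborel))" for k
          by (intro path_prob_hold_trans_measurable) auto
        have "I x i (y # xs) = hold_integral m (Suc l) (\<lambda>u. \<Sum>k\<in>UNIV. ennreal (?A x i k) *
            ennreal (path_prob (hold_trans G m (Suc l) u) 0 k ((d - x, j) # xs)))"
          unfolding I_def y using True xs A0 P0
          by (subst path_prob_jump)
             (auto simp flip: ennreal_mult sum_ennreal simp del: path_prob.simps)
        also have "\<dots> = (\<Sum>k\<in>UNIV. ennreal (?A x i k) *
            hold_integral m (Suc l) (\<lambda>u. ennreal (path_prob (hold_trans G m (Suc l) u) 0 k ((d - x, j) # xs))))"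
          by (subst hold_integral_sum, measurable)
             (intro sum.cong refl hold_integral_cmult, measurable)
        also have "\<dots> = (\<Sum>k\<in>UNIV. ennreal (?A x i k) * ennreal (V (Suc l) k ((d - x, j) # xs)))"
          using Suc.IH[OF l(2) ds] by simp
        also have "\<dots> = ennreal (\<Sum>k\<in>UNIV. ?A x i k * V (Suc l) k ((d - x, j) # xs))"
          using A0 V_nonneg[of "Suc l", OF _ ds] l
          by (simp flip: ennreal_mult sum_ennreal del: aug_path_prob.simps)
        finally have I: "I x i (y # xs) = \<dots>" .
        have "hold_density (Suc l) x * I x i (y # xs)
          = ennreal (?r * exp (- (?r * x)) * (\<Sum>k\<in>UNIV. ?A x i k * V (Suc l) k ((d - x, j) # xs)))"
          using True A0 V_nonneg[of "Suc l", OF _ ds] l rate_nonneg[of l] unfolding I hold_density_def r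
          by (subst ennreal_mult) (auto intro!: sum_nonneg mult_nonneg_nonneg simp del: aug_path_prob.simps)
        then show ?thesis
          using True by (simp add: sum_distrib_left mult_ac del: aug_path_prob.simps)
      qed (use \<open>x \<noteq> 0\<close> in \<open>auto simp: hold_density_def split: split_indicator\<close>)
    qed
    also have "(\<integral>\<^sup>+x. hold_density (Suc l) x * I x i (y # xs) * indicator {d<..} x \<partial>lborel)
      = (\<integral>\<^sup>+x. ennreal (?A d i j) * (hold_density (Suc l) x * I (x - d) j xs * indicator {d<..} x) \<partial>lborel)"
    proof (rule nn_integral_cong)
      fix x :: real
      have A0: "0 \<le> ?A d i j" using d l by (intro mexp_G_nonneg) auto
      have "I x i (y # xs) = ennreal (?A d i j) * I (x - d) j xs" if "d < x"
      proof -
        have [measurable]: "(\<lambda>u. path_prob (hold_trans G (Suc m) l (u(Suc l := x - d))) 0 j xs)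
            \<in> borel_measurable (PiM {Suc (Suc l)..Suc l + m} (\<lambda>_. lborel))"
        proof (rule path_prob_hold_trans_measurable)
          fix k assume "l < k" "k \<le> l + Suc m"
          then show "(\<lambda>u. (u(Suc l := x - d)) k)
              \<in> borel_measurable (PiM {Suc (Suc l)..Suc l + m} (\<lambda>_. lborel))"
            by (cases "k = Suc l") auto
        qed
        have "I x i (y # xs) = hold_integral m (Suc l) (\<lambda>u. ennreal (?A d i j) *
            ennreal (path_prob (hold_trans G (Suc m) l (u(Suc l := x - d))) 0 j xs))"
          unfolding I_def y path_prob_no_jump[OF d that xs]
          using A0 by (subst ennreal_mult'') (auto intro!: path_prob_hold_nonneg Suc.prems(1) xs simp del: hold_trans.simps)
        also have "\<dots> = ennreal (?A d i j) * I (x - d) j xs"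
          unfolding I_def by (intro hold_integral_cmult) measurable
        finally show ?thesis .
      qed
      then show "hold_density (Suc l) x * I x i (y # xs) * indicator {d<..} x
        = ennreal (?A d i j) * (hold_density (Suc l) x * I (x - d) j xs * indicator {d<..} x)"
        by (auto simp: mult_ac split: split_indicator)
    qed
    also have "\<dots> = ennreal (?A d i j) * (\<integral>\<^sup>+x. hold_density (Suc l) x * I (x - d) j xs * indicator {d<..} x \<partial>lborel)"
      by (rule nn_integral_cmult) measurable
    \<comment> \<open>Substitution of the residual length for the full length of the first
      piece.\<close>
    also have "(\<integral>\<^sup>+x. hold_density (Suc l) x * I (x - d) j xs * indicator {d<..} x \<partial>lborel)
       = (\<integral>\<^sup>+x. hold_density (Suc l) (d + x) * I x j xs * indicator {d<..} (d + x) \<partial>lborel)"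
      by (subst nn_integral_real_affine[where c = 1 and t = d]) auto
    also have "\<dots> = (\<integral>\<^sup>+x. ennreal (exp (- ?r * d)) * (hold_density (Suc l) x * I x j xs) \<partial>lborel)"
    proof (rule nn_integral_cong)
      fix x :: real
      \<comment> \<open>Lack of memory: the density at \<open>d + x\<close> is the survival
        probability up to \<open>d\<close> times the density at \<open>x\<close>.\<close>
      have "ennreal (?r * exp (- (?r * (d + x)))) = ennreal (exp (- ?r * d)) * ennreal (?r * exp (- (?r * x)))"
        using rate_nonneg[of l]
        by (subst ennreal_mult[symmetric]) (auto simp: exp_add[symmetric] algebra_simps)
      then show "hold_density (Suc l) (d + x) * I x j xs * indicator {d<..} (d + x)
        = ennreal (exp (- ?r * d)) * (hold_density (Suc l) x * I x j xs)"
        using d unfolding hold_density_def r by (auto simp: mult_ac split: split_indicator)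
    qed
    also have "\<dots> = ennreal (exp (- ?r * d)) * ennreal (V l j xs)"
      using Cons.IH[OF xs] unfolding peel by (subst nn_integral_cmult) auto
    also have "ennreal (?A d i j) * (ennreal (exp (- ?r * d)) * ennreal (V l j xs))
       = ennreal (exp (- ?r * d) * ?A d i j * V l j xs)"
      using d l xs by (simp add: mult_ac mexp_G_nonneg V_nonneg flip: ennreal_mult)
    also note V_first_jump[of l d xs i j, symmetric]
    finally show ?case using d l xs y by simp
  qed
qed

end

section \<open>Passage functionals on path space\<close>

text \<open>Right-continuity for the discrete topology on states. Negative times are left
  unconstrained and are never observed, hence the \<open>max 0\<close> in evaluations below.\<close>

definition rc_paths :: "(real \<Rightarrow> 'e) set" where
  "rc_paths = {y. \<forall>t\<ge>0. \<exists>\<delta>>0. \<forall>r. t \<le> r \<and> r < t + \<delta> \<longrightarrow> y r = y t}"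

definition cylinder :: "real set \<Rightarrow> (real \<Rightarrow> 'e) \<Rightarrow> (real \<Rightarrow> 'e) set" where
  "cylinder J b = {y\<in>rc_paths. \<forall>t\<in>J. y t = b t}"

text \<open>The empty set is added because two cylinders with conflicting prescriptions intersect in
  it; this gives stability under intersection.\<close>

definition cylinders :: "(real \<Rightarrow> 'e) set set" where
  "cylinders = insert {} {cylinder J b |J b. finite J \<and> J \<subseteq> {0..}}"

definition path_space :: "(real \<Rightarrow> 'e) measure" where
  "path_space = sigma rc_paths cylinders"

lemma cylinders_Pow: "cylinders \<subseteq> Pow rc_paths"
  by (auto simp: cylinders_def cylinder_def)

lemma space_path_space[simp]: "space path_space = rc_paths"
  unfolding path_space_def by (rule space_measure_of[OF cylinders_Pow])

lemma sets_path_space: "sets path_space = sigma_sets rc_paths cylinders"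
  unfolding path_space_def by (rule sets_measure_of[OF cylinders_Pow])

lemma cylinder_in_sets: "finite J \<Longrightarrow> J \<subseteq> {0..} \<Longrightarrow> cylinder J b \<in> sets path_space"
  unfolding sets_path_space by (auto simp: cylinders_def intro!: sigma_sets.Basic)

lemma Int_stable_cylinders: "Int_stable (cylinders :: (real \<Rightarrow> 'e) set set)"
proof (rule Int_stableI)
  fix A B :: "(real \<Rightarrow> 'e) set" assume "A \<in> cylinders" "B \<in> cylinders"
  then consider "A = {} \<or> B = {}"
    | J b J' b' where "A = cylinder J b" "B = cylinder J' b'" "finite J" "finite J'" "J \<subseteq> {0..}" "J' \<subseteq> {0..}"
    unfolding cylinders_def by blast
  then show "A \<inter> B \<in> cylinders"
  proof cases
    case 2
    show ?thesis
    proof (cases "\<forall>t\<in>J \<inter> J'. b t = b' t")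
      case True
      then have "A \<inter> B = cylinder (J \<union> J') (\<lambda>t. if t \<in> J then b t else b' t)"
        by (auto simp: 2 cylinder_def)
      then show ?thesis using 2 unfolding cylinders_def by blast
    next
      case False
      then have "A \<inter> B = {}" by (auto simp: 2 cylinder_def)
      then show ?thesis by (simp add: cylinders_def)
    qed
  qed (auto simp: cylinders_def)
qed

lemma measurable_path_spaceI:
  fixes f :: "'a \<Rightarrow> real \<Rightarrow> 'e::finite"
  assumes "\<And>x. x \<in> space N \<Longrightarrow> f x \<in> rc_paths"
    and "\<And>t. 0 \<le> t \<Longrightarrow> (\<lambda>x. f x t) \<in> N \<rightarrow>\<^sub>M count_space UNIV"
  shows "f \<in> N \<rightarrow>\<^sub>M path_space"
  unfolding path_space_def
proof (rule measurable_measure_of[OF cylinders_Pow])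
  fix A :: "(real \<Rightarrow> 'e) set" assume "A \<in> cylinders"
  then consider "A = {}" | J b where "A = cylinder J b" "finite J" "J \<subseteq> {0..}"
    by (auto simp: cylinders_def)
  then show "f -` A \<inter> space N \<in> sets N"
  proof cases
    case 2
    have "f -` A \<inter> space N = {x \<in> space N. \<forall>t\<in>J. f x t = b t}"
      by (auto simp: 2(1) cylinder_def intro: assms(1))
    also have "\<dots> \<in> sets N"
    proof (rule sets.sets_Collect_finite_All[OF _ \<open>finite J\<close>])
      fix t assume "t \<in> J"
      then have [measurable]: "(\<lambda>x. f x t) \<in> N \<rightarrow>\<^sub>M count_space UNIV"
        using \<open>J \<subseteq> {0..}\<close> by (intro assms(2)) auto
      show "{x \<in> space N. f x t = b t} \<in> sets N" by measurable
    qed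
    finally show ?thesis .
  qed simp
qed (rule funcsetI, rule assms(1))

lemma measurable_path_eval:
  fixes t :: real
  assumes "0 \<le> t"
  shows "(\<lambda>y. y t) \<in> (path_space :: (real \<Rightarrow> 'e::finite) measure) \<rightarrow>\<^sub>M count_space UNIV"
proof (rule measurable_count_space_eq2[THEN iffD2])
  have "(\<lambda>y. y t) -` {e} \<inter> rc_paths = cylinder {t} (\<lambda>_. e)" for e :: 'e
    by (auto simp: cylinder_def)
  then show "(\<lambda>y. y t) \<in> space (path_space :: (real \<Rightarrow> 'e) measure) \<rightarrow> UNIV \<and>
      (\<forall>a\<in>UNIV. (\<lambda>y. y t) -` {a} \<inter> space (path_space :: (real \<Rightarrow> 'e) measure) \<in> sets path_space)"
    using assms by (auto intro: cylinder_in_sets)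
qed simp

lemma rc_path_eventually:
  assumes "y \<in> rc_paths" "0 \<le> t" "f \<longlonglongrightarrow> t" "\<And>k. t \<le> f k"
  shows "\<forall>\<^sub>F k in sequentially. y (f k) = y t"
proof -
  obtain \<delta> where \<delta>: "\<delta> > 0" "\<forall>r. t \<le> r \<and> r < t + \<delta> \<longrightarrow> y r = y t"
    using assms(1,2) unfolding rc_paths_def by blast
  have "\<forall>\<^sub>F k in sequentially. f k < t + \<delta>"
    using order_tendstoD(2)[OF assms(3)] \<delta>(1) by simp
  then show ?thesis
    by (rule eventually_mono) (use \<delta>(2) assms(4) in blast)
qed

text \<open>Joint measurability in time and path: replace the time by grid times slightly to its
  right, which take countably many values, and pass to the limit by right-continuity.\<close>

lemma measurable_path_eval_pair:
  fixes g :: "'e::finite \<Rightarrow> real"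
  shows "(\<lambda>(t, y). g (y (max 0 t))) \<in> borel_measurable (borel \<Otimes>\<^sub>M path_space)"
proof (rule borel_measurable_LIMSEQ_real)
  \<comment> \<open>The added 1 places the grid point strictly to the right of the time, where
    right-continuity applies.\<close>
  define f :: "nat \<Rightarrow> real \<Rightarrow> real" where "f k t = (\<lfloor>real (Suc k) * max 0 t\<rfloor> + 1) / real (Suc k)" for k t
  fix k :: nat
  \<comment> \<open>Composition over a countable index needs measurability for every integer
    \<open>i\<close>, so negative ones are clipped; the floors that occur are non-negative and are
    unaffected.\<close>
  have [measurable]: "(\<lambda>y. g (y ((max 0 i + 1) / real (Suc k)))) \<in> borel_measurable path_space" for i :: int
    by (rule measurable_compose[OF measurable_path_eval]) auto
  have "(\<lambda>p. (\<lambda>i p. g ((snd p) (real_of_int (max 0 i + 1) / real (Suc k)))) \<lfloor>real (Suc k) * max 0 (fst p)\<rfloor> p)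
      \<in> borel_measurable (borel \<Otimes>\<^sub>M path_space)"
    by (rule measurable_compose_countable) measurable
  moreover have "max 0 \<lfloor>real (Suc k) * max 0 t\<rfloor> = \<lfloor>real (Suc k) * max 0 t\<rfloor>" for t :: real
    by (intro max_absorb2) (simp add: zero_le_floor)
  ultimately show "(\<lambda>(t, y). g (y (f k t))) \<in> borel_measurable (borel \<Otimes>\<^sub>M path_space)"
    by (simp add: f_def case_prod_unfold)
next
  fix p :: "real \<times> (real \<Rightarrow> 'e)" assume p: "p \<in> space (borel \<Otimes>\<^sub>M path_space)"
  obtain t y where ty: "p = (t, y)" by (cases p)
  with p have y: "y \<in> rc_paths" by (auto simp: space_pair_measure)
  define f where "f k = (\<lfloor>real (Suc k) * max 0 t\<rfloor> + 1) / real (Suc k)" for k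
  have floor: "a \<le> (\<lfloor>r * a\<rfloor> + 1) / r" "(\<lfloor>r * a\<rfloor> + 1) / r \<le> a + 1 / r" if "0 < r" for a r :: real
  proof -
    have "r * a \<le> \<lfloor>r * a\<rfloor> + 1" "\<lfloor>r * a\<rfloor> + 1 \<le> r * a + 1" by linarith+
    then show "a \<le> (\<lfloor>r * a\<rfloor> + 1) / r" "(\<lfloor>r * a\<rfloor> + 1) / r \<le> a + 1 / r"
      using that by (simp_all add: field_simps)
  qed
  have ge: "max 0 t \<le> f k" and le: "f k \<le> max 0 t + 1 / real (Suc k)" for k
    unfolding f_def by (rule floor; simp)+
  have "f \<longlonglongrightarrow> max 0 t"
  proof (rule tendsto_sandwich[where f = "\<lambda>_. max 0 t" and h = "\<lambda>k. max 0 t + 1 / real (Suc k)"])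
    show "(\<lambda>k. max 0 t + 1 / real (Suc k)) \<longlonglongrightarrow> max 0 t"
      using tendsto_add[OF tendsto_const LIMSEQ_inverse_real_of_nat] by (simp add: inverse_eq_divide)
  qed (use ge le in \<open>auto simp del: of_nat_Suc max.bounded_iff\<close>)
  then have "\<forall>\<^sub>F k in sequentially. g (y (f k)) = g (y (max 0 t))"
    by (intro eventually_mono[OF rc_path_eventually[OF y _ _ ge]]) auto
  then show "(\<lambda>k. (\<lambda>(t, y). g (y ((\<lfloor>real (Suc k) * max 0 t\<rfloor> + 1) / real (Suc k)))) p)
      \<longlonglongrightarrow> (\<lambda>(t, y). g (y (max 0 t))) p"
    by (auto simp: ty f_def intro: tendsto_eventually)
qed

lemma path_set_integrable:
  fixes v :: "'e::finite \<Rightarrow> real"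
  assumes "y \<in> rc_paths"
  shows "set_integrable lborel {0..t} (\<lambda>u. v (y (max 0 u)))"
proof -
  have [measurable]: "(\<lambda>u. v (y (max 0 u))) \<in> borel_measurable borel"
    using measurable_compose[OF measurable_Pair2'[of y path_space borel] measurable_path_eval_pair[of v]] assms
    by simp
  show ?thesis
    unfolding set_integrable_def
  proof (rule integrableI_bounded_set[where A = "{0..t}" and B = "Max (range (\<lambda>e. \<bar>v e\<bar>))"])
    show "AE x in lborel. x \<in> {0..t} \<longrightarrow> norm (indicator {0..t} x *\<^sub>R v (y (max 0 x))) \<le> Max (range (\<lambda>e. \<bar>v e\<bar>))"
      by (auto split: split_indicator intro!: Max_ge)
  qed (auto split: split_indicator simp: emeasure_lborel_Icc_eq)
qed

section \<open>Measurability of occupation integrals and passage times\<close>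

text \<open>Passing from the gauge integral to a Lebesgue integral gives access to measurability of
  integrals depending on a parameter.\<close>

lemma occ_eq_lebesgue:
  fixes v :: "'e::finite \<Rightarrow> real"
  assumes "y \<in> rc_paths"
  shows "occ v y t = (\<integral>u. indicator {0..t} u * v (y (max 0 u)) \<partial>lborel)"
proof -
  have "occ v y t = integral {0..t} (\<lambda>u. v (y (max 0 u)))"
    unfolding occ_def by (intro Henstock_Kurzweil_Integration.integral_cong) auto
  then show ?thesis
    using set_borel_integral_eq_integral(2)[OF path_set_integrable[OF assms, of t v]]
    by (simp add: set_lebesgue_integral_def)
qed

lemma occ_measurable[measurable]:
  fixes v :: "'e::finite \<Rightarrow> real"
  shows "(\<lambda>y. occ v y t) \<in> borel_measurable path_space"
proof -
  have [measurable]: "(\<lambda>p. v ((fst p) (max 0 (snd p)))) \<in> borel_measurable (path_space \<Otimes>\<^sub>M lborel)"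
    using measurable_compose[OF measurable_Pair[OF measurable_snd measurable_fst] measurable_path_eval_pair[of v]]
    by simp
  have "(\<lambda>y. \<integral>u. indicator {0..t} u * v (y (max 0 u)) \<partial>lborel) \<in> borel_measurable path_space"
    by (rule lborel.borel_measurable_lebesgue_integral) (simp add: case_prod_unfold)
  then show ?thesis
    by (rule measurable_cong[THEN iffD1, rotated]) (simp add: occ_eq_lebesgue)
qed

text \<open>\<open>occ\<close> is continuous in time, so a strict inequality persists at some
  rational time slightly to the right; this reduces passage events to countably many times.\<close>

lemma occ_gt_rational:
  fixes v :: "'e::finite \<Rightarrow> real"
  assumes y: "y \<in> rc_paths" and r: "0 \<le> r" "x < occ v y r" "r < a"
  shows "\<exists>p::rat. 0 \<le> p \<and> of_rat p < a \<and> x < occ v y (of_rat p)"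
proof -
  have eq: "occ v y s = integral {0..s} (\<lambda>u. v (y (max 0 u)))" for s
    unfolding occ_def by (intro Henstock_Kurzweil_Integration.integral_cong) auto
  have "continuous_on {0..a} (\<lambda>s. occ v y s)"
    unfolding eq using set_borel_integral_eq_integral(1)[OF path_set_integrable[OF y, of a v]]
    by (rule indefinite_integral_continuous_1)
  then have "continuous (at r within {0..a}) (occ v y)"
    using r by (simp add: continuous_on_eq_continuous_within)
  then have "\<forall>\<^sub>F s in at r within {0..a}. x < occ v y s"
    using r(2) by (auto simp: continuous_within intro: order_tendstoD(1))
  then obtain d where d: "0 < d" "\<And>s. s \<in> {0..a} \<Longrightarrow> s \<noteq> r \<Longrightarrow> dist s r < d \<Longrightarrow> x < occ v y s"
    by (auto simp: eventually_at)
  obtain p where p: "r < of_rat p" "of_rat p < min a (r + d)"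
    using of_rat_dense[of r "min a (r + d)"] r d by auto
  have "(0::real) < of_rat p" using p r by linarith
  then have "0 \<le> p" by simp
  moreover have "x < occ v y (of_rat p)"
    using p r \<open>0 \<le> p\<close> by (intro d(2)) (auto simp: dist_real_def)
  ultimately show ?thesis using p by auto
qed

text \<open>The passage time lies below \<open>a\<close> exactly if the level \<open>x\<close> is
  exceeded at some rational time below \<open>a\<close>, a countable union of measurable events. The
  state at passage is then a joint evaluation at a measurable time.\<close>

lemma passage_fun_measurable:
  fixes v :: "'e::finite \<Rightarrow> real"
  shows "(\<lambda>y. passage_fun c v y x j) \<in> borel_measurable path_space"
proof -
  define H where "H y \<longleftrightarrow> (\<exists>r\<ge>0. x < occ v y r)" for y :: "real \<Rightarrow> 'e"
  \<comment> \<open>The default 0 replaces an infimum over the empty set and keeps \<open>f\<close>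
    non-negative, as evaluation at time \<open>f y\<close> requires.\<close>
  define f where "f y = (if H y then fpt v y x else 0)" for y
  have H: "H y \<longleftrightarrow> (\<exists>p::rat. 0 \<le> p \<and> x < occ v y (of_rat p))" if "y \<in> rc_paths" for y
  proof
    assume "H y"
    then obtain r where "0 \<le> r" "x < occ v y r" by (auto simp: H_def)
    from occ_gt_rational[OF that this less_add_one]
    show "\<exists>p::rat. 0 \<le> p \<and> x < occ v y (of_rat p)" by blast
  next
    assume "\<exists>p::rat. 0 \<le> p \<and> x < occ v y (of_rat p)"
    then obtain p :: rat where "0 \<le> p" "x < occ v y (of_rat p)" by blast
    then show "H y" unfolding H_def by (intro exI[of _ "of_rat p"]) simp
  qed
  have "{y \<in> rc_paths. H y} = {y \<in> space path_space. \<exists>p::rat. 0 \<le> p \<and> x < occ v y (of_rat p)}"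
    using H by auto
  also have "\<dots> \<in> sets path_space" by measurable
  finally have [measurable]: "Measurable.pred path_space H"
    by (simp add: pred_def)
  have f_less: "f y < a \<longleftrightarrow> (H y \<and> (\<exists>p::rat. 0 \<le> p \<and> of_rat p < a \<and> x < occ v y (of_rat p))) \<or> (\<not> H y \<and> 0 < a)"
    if y: "y \<in> rc_paths" for y a
  proof (cases "H y")
    case True
    have "fpt v y x < a \<longleftrightarrow> (\<exists>r. 0 \<le> r \<and> x < occ v y r \<and> r < a)"
      unfolding fpt_def using True by (subst cInf_less_iff) (auto simp: H_def intro!: bdd_belowI[of _ 0])
    also have "\<dots> \<longleftrightarrow> (\<exists>p::rat. 0 \<le> p \<and> of_rat p < a \<and> x < occ v y (of_rat p))"
    proof
      assume "\<exists>r. 0 \<le> r \<and> x < occ v y r \<and> r < a"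
      then show "\<exists>p::rat. 0 \<le> p \<and> of_rat p < a \<and> x < occ v y (of_rat p)"
        using occ_gt_rational[OF y] by blast
    next
      assume "\<exists>p::rat. 0 \<le> p \<and> of_rat p < a \<and> x < occ v y (of_rat p)"
      then obtain p :: rat where "0 \<le> p" "of_rat p < a" "x < occ v y (of_rat p)" by blast
      then show "\<exists>r. 0 \<le> r \<and> x < occ v y r \<and> r < a"
        by (intro exI[of _ "of_rat p"]) simp
    qed
    finally show ?thesis using True by (simp add: f_def)
  qed (simp add: f_def)
  have [measurable]: "f \<in> borel_measurable path_space"
    unfolding borel_measurable_iff_less
  proof
    fix a
    have "{y \<in> space path_space. f y < a} = {y \<in> space path_space.
      (H y \<and> (\<exists>p::rat. 0 \<le> p \<and> of_rat p < a \<and> x < occ v y (of_rat p))) \<or> (\<not> H y \<and> 0 < a)}"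
      using f_less by auto
    also have "\<dots> \<in> sets path_space" by measurable
    finally show "{y \<in> space path_space. f y < a} \<in> sets path_space" .
  qed
  have f_nonneg: "0 \<le> f y" for y
    unfolding f_def fpt_def H_def by (auto intro!: cInf_greatest)
  have "(\<lambda>y. (f y, y)) \<in> path_space \<rightarrow>\<^sub>M borel \<Otimes>\<^sub>M path_space" by measurable
  from measurable_compose[OF this measurable_path_eval_pair[of "\<lambda>e. if e = j then 1 else 0"]]
  have [measurable]: "(\<lambda>y. if y (f y) = j then 1 else 0 :: real) \<in> borel_measurable path_space"
    using f_nonneg by (simp add: max_absorb2)
  have "(\<lambda>y. passage_fun c v y x j) = (\<lambda>y. if H y then exp (- c * f y) * (if y (f y) = j then 1 else 0) else 0)"
    by (auto simp: passage_fun_def H_def f_def fun_eq_iff)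
  also have "\<dots> \<in> borel_measurable path_space" by measurable
  finally show ?thesis .
qed

lemma passage_fun_bounds:
  assumes "0 \<le> c"
  shows "0 \<le> passage_fun c v y x j" "passage_fun c v y x j \<le> 1"
proof -
  have "0 \<le> fpt v y x" if "\<exists>r\<ge>0. x < occ v y r"
    unfolding fpt_def using that by (auto intro!: cInf_greatest)
  then show "0 \<le> passage_fun c v y x j" "passage_fun c v y x j \<le> 1"
    using assms by (auto simp: passage_fun_def)
qed

section \<open>Finite-dimensional laws of the two chains\<close>

fun increments :: "real \<Rightarrow> (real \<times> 's) list \<Rightarrow> (real \<times> 's) list" where
  "increments a [] = []"
| "increments a (x # xs) = (fst x - a, snd x) # increments (fst x) xs"

definition observations :: "real set \<Rightarrow> (real \<Rightarrow> 's) \<Rightarrow> (real \<times> 's) list" where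
  "observations J b = increments 0 (map (\<lambda>t. (t, b t)) (sorted_list_of_set J))"

lemma increments_nonneg:
  "sorted (a # map fst xs) \<Longrightarrow> x \<in> set (increments a xs) \<Longrightarrow> 0 \<le> fst x"
  by (induction a xs rule: increments.induct) auto

lemma sorted_observation_times:
  fixes J :: "real set"
  assumes "finite J" "J \<subseteq> {0..}"
  shows "sorted (0 # sorted_list_of_set J)"
  using assms by auto

lemma observations_nonneg:
  assumes "finite J" "J \<subseteq> {0..}"
  shows "\<forall>x\<in>set (observations J b). 0 \<le> fst x"
  using increments_nonneg[of 0 "map (\<lambda>t. (t, b t)) (sorted_list_of_set J)"] sorted_observation_times[OF assms]
  unfolding observations_def by (auto simp: comp_def)

lemma prod_eq_path_prob:
  "length is = length ts \<Longrightarrow>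
    (\<Prod>k<length ts. P ((a # ts) ! k) (ts ! k) ((i # is) ! k) (is ! k))
      = path_prob P a i (increments a (zip ts is))"
proof (induction ts arbitrary: a i "is")
  case (Cons t ts)
  then obtain j js where "is = j # js" "length js = length ts" by (cases "is") auto
  then show ?case
    using Cons.IH[of js t j] by (simp add: prod.lessThan_Suc_shift del: prod.lessThan_Suc)
qed simp

lemma markov_chain_path_prob:
  assumes "markov_chain N S P X" "sorted (0 # ts)" "length is = length ts"
  shows "measure N {\<omega>\<in>space N. X 0 \<omega> = i \<and> (\<forall>k<length ts. X (ts ! k) \<omega> = is ! k)}
    = measure N {\<omega>\<in>space N. X 0 \<omega> = i} * path_prob P 0 i (increments 0 (zip ts is))"
proof -
  have "length (i # is) = length ts + 1" using assms(3) by simp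
  then have "measure N {\<omega>\<in>space N. \<forall>k<length (i # is). X ((0 # ts) ! k) \<omega> = (i # is) ! k}
      = measure N {\<omega>\<in>space N. X 0 \<omega> = (i # is) ! 0} *
          (\<Prod>k<length ts. P ((0 # ts) ! k) (ts ! k) ((i # is) ! k) ((i # is) ! Suc k))"
  proof -
    have "\<forall>(ts::real list) is. length is = length ts + 1 \<longrightarrow> sorted (0 # ts) \<longrightarrow>
        measure N {\<omega>\<in>space N. \<forall>k<length is. X ((0 # ts) ! k) \<omega> = is ! k} =
        measure N {\<omega>\<in>space N. X 0 \<omega> = is ! 0} *
          (\<Prod>k<length ts. P ((0 # ts) ! k) (ts ! k) (is ! k) (is ! Suc k))"
      using assms(1) unfolding markov_chain_def by (elim conjE)
    then show ?thesis using \<open>length (i # is) = length ts + 1\<close> assms(2) by blast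
  qed
  moreover have "(\<forall>k<length (i # is). X ((0 # ts) ! k) \<omega> = (i # is) ! k)
      \<longleftrightarrow> X 0 \<omega> = i \<and> (\<forall>k<length ts. X (ts ! k) \<omega> = is ! k)" for \<omega>
    using assms(3) by (auto simp: less_Suc_eq_0_disj)
  ultimately show ?thesis
    using prod_eq_path_prob[OF assms(3), of P 0 i] by simp
qed

lemma markov_chain_measurable:
  "markov_chain N S P X \<Longrightarrow> 0 \<le> t \<Longrightarrow> X t \<in> N \<rightarrow>\<^sub>M count_space UNIV"
  by (simp add: markov_chain_def)

lemma markov_chain_rc_paths:
  "markov_chain N S P X \<Longrightarrow> \<omega> \<in> space N \<Longrightarrow> (\<lambda>t. X t \<omega>) \<in> rc_paths"
  by (simp add: markov_chain_def rc_paths_def)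

lemma rc_paths_comp:
  assumes "y \<in> rc_paths"
  shows "(\<lambda>t. f (y t)) \<in> rc_paths"
  unfolding rc_paths_def
proof (intro CollectI allI impI)
  fix t :: real assume "0 \<le> t"
  then obtain \<delta> where "\<delta> > 0" "\<forall>r. t \<le> r \<and> r < t + \<delta> \<longrightarrow> y r = y t"
    using assms unfolding rc_paths_def by blast
  then show "\<exists>\<delta>>0. \<forall>r. t \<le> r \<and> r < t + \<delta> \<longrightarrow> f (y r) = f (y t)"
    by (intro exI[of _ \<delta>] conjI allI impI arg_cong[of _ _ f]) blast+
qed

lemma all_nth_sorted_list_of_set:
  fixes J :: "real set"
  assumes "finite J"
  shows "(\<forall>k<length (sorted_list_of_set J). Q (sorted_list_of_set J ! k)) \<longleftrightarrow> (\<forall>t\<in>J. Q t)"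
  using all_set_conv_all_nth[of "sorted_list_of_set J" Q] by (simp only: set_sorted_list_of_set[OF assms])

lemma markov_chain_cylinder:
  assumes "markov_chain N S P X" "finite J" "J \<subseteq> {0..}"
  shows "measure N {\<omega>\<in>space N. X 0 \<omega> = i \<and> (\<forall>t\<in>J. X t \<omega> = b t)}
    = measure N {\<omega>\<in>space N. X 0 \<omega> = i} * path_prob P 0 i (observations J b)"
proof -
  let ?ts = "sorted_list_of_set J"
  have "(\<forall>k<length ?ts. X (?ts ! k) \<omega> = map b ?ts ! k) \<longleftrightarrow> (\<forall>t\<in>J. X t \<omega> = b t)" for \<omega>
    using all_nth_sorted_list_of_set[OF assms(2), of "\<lambda>t. X t \<omega> = b t"] by simp
  then show ?thesis
    using markov_chain_path_prob[OF assms(1) sorted_observation_times[OF assms(2,3)], of "map b ?ts" i]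
    by (simp add: observations_def zip_map2 zip_same_conv_map comp_def)
qed

lemma sum_lists_length_Suc:
  assumes "finite A"
  shows "(\<Sum>xs | set xs \<subseteq> A \<and> length xs = Suc m. f xs)
    = (\<Sum>x\<in>A. \<Sum>xs | set xs \<subseteq> A \<and> length xs = m. f (x # xs))"
proof -
  have "(\<Sum>x\<in>A. \<Sum>xs | set xs \<subseteq> A \<and> length xs = m. f (x # xs))
    = (\<Sum>p\<in>A \<times> {xs. set xs \<subseteq> A \<and> length xs = m}. f (fst p # snd p))"
    by (simp add: sum.cartesian_product case_prod_unfold)
  also have "\<dots> = (\<Sum>xs | set xs \<subseteq> A \<and> length xs = Suc m. f xs)"
    by (rule sum.reindex_bij_witness[where j = "\<lambda>p. fst p # snd p" and i = "\<lambda>xs. (hd xs, tl xs)"])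
       (auto simp: length_Suc_conv)
  finally show ?thesis by simp
qed

text \<open>The transition product over a level sequence factors, so summing over all sequences can
  be done one level at a time.\<close>

lemma sum_levels_path_prob:
  "(\<Sum>ls | set ls \<subseteq> {0..n} \<and> length ls = length ts.
      path_prob (\<lambda>a b. aug_trans n G q (b - a)) a (l, i) (increments a (zip ts (zip ls (map b ts)))))
    = aug_path_prob n G q l i (increments a (map (\<lambda>t. (t, b t)) ts))"
proof (induction ts arbitrary: a l i)
  case Nil
  have "{ls. set ls \<subseteq> {0..n} \<and> length ls = length []} = {[]}" by auto
  then show ?case by simp
next
  case (Cons t ts)
  show ?case
    by (simp add: sum_lists_length_Suc Cons.IH flip: sum_distrib_left)
qed

text \<open>The second component need not be Markov on its own. The event is split according to the
  levels at the observation times, and the finite-dimensional law of \<open>Z\<close> is applied to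
  each part.\<close>

lemma aug_chain_cylinder:
  fixes Z :: "real \<Rightarrow> 'b \<Rightarrow> nat \<times> 'e::finite"
  assumes chain: "markov_chain N ({0..n} \<times> UNIV) (\<lambda>a b. aug_trans n G q (b - a)) Z"
    and start: "AE \<omega> in N. Z 0 \<omega> = (0, i)"
    and J: "finite J" "J \<subseteq> {0..}"
  shows "measure N {\<omega>\<in>space N. \<forall>t\<in>J. snd (Z t \<omega>) = b t} = aug_path_prob n G q 0 i (observations J b)"
proof -
  interpret prob_space N using chain by (simp add: markov_chain_def)
  let ?ts = "sorted_list_of_set J"
  let ?L = "{ls. set ls \<subseteq> {0..n} \<and> length ls = length ?ts}"
  define E where "E ls = {\<omega>\<in>space N. Z 0 \<omega> = (0, i) \<and> (\<forall>k<length ?ts. Z (?ts ! k) \<omega> = zip ls (map b ?ts) ! k)}" for ls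
  have [measurable]: "Z t \<in> N \<rightarrow>\<^sub>M count_space UNIV" if "0 \<le> t" for t
    using markov_chain_measurable[OF chain that] .
  have pos: "0 \<le> ?ts ! k" if "k < length ?ts" for k
    using J that nth_mem[OF that] by auto
  have E_sets: "E ls \<in> sets N" for ls
  proof -
    have "{\<omega> \<in> space N. \<forall>k\<in>{..<length ?ts}. Z (?ts ! k) \<omega> = zip ls (map b ?ts) ! k} \<in> sets N"
    proof (rule sets.sets_Collect_finite_All)
      fix k assume "k \<in> {..<length ?ts}"
      then have [measurable]: "Z (?ts ! k) \<in> N \<rightarrow>\<^sub>M count_space UNIV"
        by (intro markov_chain_measurable[OF chain] pos) simp
      show "{\<omega> \<in> space N. Z (?ts ! k) \<omega> = zip ls (map b ?ts) ! k} \<in> sets N" by measurable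
    qed simp
    moreover have "{\<omega> \<in> space N. Z 0 \<omega> = (0, i)} \<in> sets N" by measurable
    ultimately show ?thesis
      unfolding E_def lessThan_iff Ball_def by (intro sets.sets_Collect_conj)
  qed
  have finite_L: "finite ?L" by (rule finite_lists_length_eq) simp
  have "E ls \<inter> E ls' = {}" if "ls \<in> ?L" "ls' \<in> ?L" "ls \<noteq> ls'" for ls ls'
  proof -
    have len: "length ls = length ?ts" "length ls' = length ?ts" using that by auto
    then obtain k where k: "k < length ?ts" "ls ! k \<noteq> ls' ! k"
      using \<open>ls \<noteq> ls'\<close> nth_equalityI[of ls ls'] by metis
    then have "zip ls (map b ?ts) ! k \<noteq> zip ls' (map b ?ts) ! k" using len by simp
    then show ?thesis using k(1) unfolding E_def by fastforce
  qed
  then have disj: "disjoint_family_on E ?L" by (auto simp: disjoint_family_on_def)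
  have "measure N {\<omega>\<in>space N. \<forall>t\<in>J. snd (Z t \<omega>) = b t} = measure N (\<Union>ls\<in>?L. E ls)"
  \<comment> \<open>Equality holds up to a null set only: each \<open>E ls\<close> demands the start
    \<open>(0, i)\<close>, which is known almost surely. The converse direction reads the level
    sequence off the path.\<close>
  proof (rule finite_measure_eq_AE)
    show "AE \<omega> in N. \<omega> \<in> {\<omega>\<in>space N. \<forall>t\<in>J. snd (Z t \<omega>) = b t} \<longleftrightarrow> \<omega> \<in> (\<Union>ls\<in>?L. E ls)"
      using start AE_space
    proof eventually_elim
      case (elim \<omega>)
      have J_iff: "(\<forall>t\<in>J. snd (Z t \<omega>) = b t) \<longleftrightarrow> (\<forall>k<length ?ts. snd (Z (?ts ! k) \<omega>) = b (?ts ! k))"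
        using all_nth_sorted_list_of_set[OF J(1), of "\<lambda>t. snd (Z t \<omega>) = b t"] by simp
      have "\<omega> \<in> E (map (\<lambda>t. fst (Z t \<omega>)) ?ts)" if "\<forall>t\<in>J. snd (Z t \<omega>) = b t"
        using elim that unfolding J_iff E_def by (auto simp: prod_eq_iff)
      moreover have "map (\<lambda>t. fst (Z t \<omega>)) ?ts \<in> ?L"
      proof -
        have "Z t \<omega> \<in> {0..n} \<times> UNIV" if "t \<in> J" for t
          using chain elim(2) that J unfolding markov_chain_def by auto
        then show ?thesis using \<open>finite J\<close> by (auto simp: mem_Times_iff)
      qed
      moreover have "\<forall>t\<in>J. snd (Z t \<omega>) = b t" if "ls \<in> ?L" "\<omega> \<in> E ls" for ls
        using that unfolding J_iff E_def by auto
      ultimately show ?case using elim(2) by blast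
    qed
    show "{\<omega>\<in>space N. \<forall>t\<in>J. snd (Z t \<omega>) = b t} \<in> sets N"
    proof (rule sets.sets_Collect_finite_All[OF _ J(1)])
      fix t assume "t \<in> J"
      then have "Z t \<in> N \<rightarrow>\<^sub>M count_space UNIV" using J by auto
      then have [measurable]: "(\<lambda>\<omega>. snd (Z t \<omega>)) \<in> N \<rightarrow>\<^sub>M count_space UNIV"
        by (rule measurable_compose) simp
      show "{\<omega> \<in> space N. snd (Z t \<omega>) = b t} \<in> sets N" by measurable
    qed
  qed (use E_sets finite_L in \<open>auto intro: sets.finite_UN\<close>)
  also have "\<dots> = (\<Sum>ls\<in>?L. measure N (E ls))"
    using E_sets finite_L disj by (intro finite_measure_finite_Union) auto
  also have "\<dots> = (\<Sum>ls\<in>?L. path_prob (\<lambda>a b. aug_trans n G q (b - a)) 0 (0, i)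
      (increments 0 (zip ?ts (zip ls (map b ?ts)))))"
  proof (rule sum.cong)
    fix ls assume "ls \<in> ?L"
    then have "measure N (E ls) = measure N {\<omega>\<in>space N. Z 0 \<omega> = (0, i)} *
        path_prob (\<lambda>a b. aug_trans n G q (b - a)) 0 (0, i) (increments 0 (zip ?ts (zip ls (map b ?ts))))"
      unfolding E_def
      by (intro markov_chain_path_prob[OF chain sorted_observation_times[OF J]]) simp
    moreover have "measure N {\<omega>\<in>space N. Z 0 \<omega> = (0, i)} = 1"
      using start by (subst prob_Collect_eq_1) auto
    ultimately show "measure N (E ls) = path_prob (\<lambda>a b. aug_trans n G q (b - a)) 0 (0, i)
      (increments 0 (zip ?ts (zip ls (map b ?ts))))" by simp
  qed simp
  also have "\<dots> = aug_path_prob n G q 0 i (observations J b)"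
    unfolding observations_def by (rule sum_levels_path_prob)
  finally show ?thesis .
qed

section \<open>Path laws conditional on the starting state\<close>

text \<open>Conditioning on the start, which has positive probability, is encoded as restriction and
  normalisation; \<open>cond_exp_start\<close> of a path functional is its integral against this
  law.\<close>

definition start_law :: "'a measure \<Rightarrow> (real \<Rightarrow> 'a \<Rightarrow> 'e) \<Rightarrow> 'e \<Rightarrow> (real \<Rightarrow> 'e) measure" where
  "start_law N X i = distr (uniform_measure N {\<omega>\<in>space N. X 0 \<omega> = i}) path_space (\<lambda>\<omega> t. X t \<omega>)"

lemma markov_chain_path_measurable:
  fixes X :: "real \<Rightarrow> 'a \<Rightarrow> 's" and f :: "'s \<Rightarrow> 'e::finite"
  assumes "markov_chain N S P X"
  shows "(\<lambda>\<omega> t. f (X t \<omega>)) \<in> N \<rightarrow>\<^sub>M path_space"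
proof (rule measurable_path_spaceI)
  fix t :: real assume "0 \<le> t"
  from markov_chain_measurable[OF assms this]
  show "(\<lambda>\<omega>. f (X t \<omega>)) \<in> N \<rightarrow>\<^sub>M count_space UNIV" by (rule measurable_compose) simp
qed (rule rc_paths_comp[OF markov_chain_rc_paths[OF assms]])

locale started_chain =
  fixes N :: "'a measure" and P and X :: "real \<Rightarrow> 'a \<Rightarrow> 'e::finite" and i :: 'e
  assumes chain: "markov_chain N UNIV P X"
    and start_pos: "0 < measure N {\<omega>\<in>space N. X 0 \<omega> = i}"
begin

sublocale prob_space N using chain by (simp add: markov_chain_def)

abbreviation "start_event \<equiv> {\<omega>\<in>space N. X 0 \<omega> = i}"

lemma start_event_sets[measurable]: "start_event \<in> sets N"
proof -
  have [measurable]: "X 0 \<in> N \<rightarrow>\<^sub>M count_space UNIV" using markov_chain_measurable[OF chain] by simp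
  show ?thesis by measurable
qed

lemma path_measurable[measurable]: "(\<lambda>\<omega> t. X t \<omega>) \<in> N \<rightarrow>\<^sub>M path_space"
  by (rule markov_chain_path_measurable[OF chain, of "\<lambda>x. x"])

lemma prob_space_start_law: "prob_space (start_law N X i)"
  unfolding start_law_def using start_pos
  by (intro prob_space.prob_space_distr prob_space_uniform_measure) (auto simp: emeasure_eq_measure)

lemma emeasure_start_law_cylinder:
  assumes "finite J" "J \<subseteq> {0..}"
  shows "emeasure (start_law N X i) (cylinder J b) = ennreal (path_prob P 0 i (observations J b))"
proof -
  have [measurable]: "cylinder J b \<in> sets path_space" using assms by (rule cylinder_in_sets)
  interpret L: prob_space "start_law N X i" by (rule prob_space_start_law)
  have "L.prob (cylinder J b) = measure (uniform_measure N start_event) ((\<lambda>\<omega> t. X t \<omega>) -` cylinder J b \<inter> space N)"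
    unfolding start_law_def by (subst measure_distr) auto
  also have "\<dots> = measure N (start_event \<inter> ((\<lambda>\<omega> t. X t \<omega>) -` cylinder J b \<inter> space N)) / measure N start_event"
    using start_pos by (intro measure_uniform_measure) (auto simp: emeasure_eq_measure)
  also have "start_event \<inter> ((\<lambda>\<omega> t. X t \<omega>) -` cylinder J b \<inter> space N)
      = {\<omega>\<in>space N. X 0 \<omega> = i \<and> (\<forall>t\<in>J. X t \<omega> = b t)}"
    by (auto simp: cylinder_def intro: markov_chain_rc_paths[OF chain])
  also have "measure N \<dots> / measure N start_event = path_prob P 0 i (observations J b)"
    using start_pos by (simp add: markov_chain_cylinder[OF chain assms])
  finally show ?thesis by (simp add: L.emeasure_eq_measure)
qed

text \<open>Links the real quotient to the extended non-negative integral. Non-negativity is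
  recorded separately because \<open>ennreal\<close> would hide a negative value.\<close>

lemma cond_exp_start_eq:
  fixes f :: "(real \<Rightarrow> 'e) \<Rightarrow> real"
  assumes [measurable]: "f \<in> borel_measurable path_space" and f: "\<And>y. 0 \<le> f y" "\<And>y. f y \<le> 1"
  shows "ennreal (cond_exp_start N X i (\<lambda>\<omega>. f (\<lambda>t. X t \<omega>))) = (\<integral>\<^sup>+y. ennreal (f y) \<partial>start_law N X i)"
    and "0 \<le> cond_exp_start N X i (\<lambda>\<omega>. f (\<lambda>t. X t \<omega>))"
proof -
  let ?g = "\<lambda>\<omega>. f (\<lambda>t. X t \<omega>) * indicator start_event \<omega>"
  have int: "integrable N ?g"
    by (rule integrable_const_bound[where B = 1]) (use f in \<open>auto simp: abs_mult split: split_indicator\<close>)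
  have "(\<integral>\<^sup>+y. ennreal (f y) \<partial>start_law N X i)
      = (\<integral>\<^sup>+\<omega>. ennreal (f (\<lambda>t. X t \<omega>)) \<partial>uniform_measure N start_event)"
    unfolding start_law_def by (rule nn_integral_distr) auto
  also have "\<dots> = (\<integral>\<^sup>+\<omega>. ennreal (f (\<lambda>t. X t \<omega>)) * indicator start_event \<omega> \<partial>N) / emeasure N start_event"
    by (rule nn_integral_uniform_measure) auto
  also have "(\<integral>\<^sup>+\<omega>. ennreal (f (\<lambda>t. X t \<omega>)) * indicator start_event \<omega> \<partial>N) = (\<integral>\<^sup>+\<omega>. ennreal (?g \<omega>) \<partial>N)"
    by (intro nn_integral_cong) (auto split: split_indicator)
  also have "\<dots> = ennreal (\<integral>\<omega>. ?g \<omega> \<partial>N)"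
    using f by (intro nn_integral_eq_integral[OF int]) auto
  also have "\<dots> / emeasure N start_event = ennreal ((\<integral>\<omega>. ?g \<omega> \<partial>N) / measure N start_event)"
    using start_pos f by (simp add: emeasure_eq_measure divide_ennreal integral_nonneg_AE)
  finally show "ennreal (cond_exp_start N X i (\<lambda>\<omega>. f (\<lambda>t. X t \<omega>))) = (\<integral>\<^sup>+y. ennreal (f y) \<partial>start_law N X i)"
    by (simp add: cond_exp_start_def)
  show "0 \<le> cond_exp_start N X i (\<lambda>\<omega>. f (\<lambda>t. X t \<omega>))"
    unfolding cond_exp_start_def using f by (intro divide_nonneg_nonneg integral_nonneg_AE) auto
qed

end

section \<open>The law of the second component as a mixture\<close>

context holding_rates
begin

lemma pos_orthant_pred[measurable]:
  "Measurable.pred (PiM {1..n} (\<lambda>_. lborel)) (\<lambda>u. u \<in> pos_orthant n)"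
  unfolding pos_orthant_def mem_Collect_eq by measurable

text \<open>Measurability in \<open>u\<close> has to be checked on cylinders only. There the mass is
  the explicit \<open>path_prob\<close> on the orthant and a constant off it, regardless of the
  probability spaces that carry the chains.\<close>

lemma kernel_measurable:
  fixes \<kappa> :: "(nat \<Rightarrow> real) \<Rightarrow> (real \<Rightarrow> 'e) measure"
  assumes prob: "\<And>u. prob_space (\<kappa> u)" and sets: "\<And>u. sets (\<kappa> u) = sets path_space"
    and cyl: "\<And>u J b. u \<in> pos_orthant n \<Longrightarrow> finite J \<Longrightarrow> J \<subseteq> {0..} \<Longrightarrow>
      emeasure (\<kappa> u) (cylinder J b) = ennreal (path_prob (hold_trans G n 0 u) 0 i (observations J b))"
    and outside: "\<And>u. u \<notin> pos_orthant n \<Longrightarrow> \<kappa> u = L"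
  shows "\<kappa> \<in> PiM {1..n} (\<lambda>_. lborel) \<rightarrow>\<^sub>M subprob_algebra path_space"
proof (rule measurable_subprob_algebra_generated[OF sets_path_space Int_stable_cylinders cylinders_Pow])
  fix A :: "(real \<Rightarrow> 'e) set" assume "A \<in> cylinders"
  then consider "A = {}" | J b where "A = cylinder J b" "finite J" "J \<subseteq> {0..}"
    by (auto simp: cylinders_def)
  then show "(\<lambda>u. emeasure (\<kappa> u) A) \<in> borel_measurable (PiM {1..n} (\<lambda>_. lborel))"
  proof cases
    case 2
    have [measurable]: "(\<lambda>u. path_prob (hold_trans G n 0 u) 0 i (observations J b))
        \<in> borel_measurable (PiM {1..n} (\<lambda>_. lborel))"
      by (rule path_prob_hold_trans_measurable) auto
    have "(\<lambda>u. emeasure (\<kappa> u) A) = (\<lambda>u. if u \<in> pos_orthant n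
        then ennreal (path_prob (hold_trans G n 0 u) 0 i (observations J b)) else emeasure L A)"
      using cyl[OF _ 2(2,3)] outside by (auto simp: 2(1) fun_eq_iff)
    also have "\<dots> \<in> borel_measurable (PiM {1..n} (\<lambda>_. lborel))" by measurable
    finally show ?thesis .
  qed simp
next
  have "emeasure (\<kappa> u) rc_paths = 1" for u
    using prob_space.emeasure_space_1[OF prob[of u]] sets_eq_imp_space_eq[OF sets[of u]] by simp
  then show "(\<lambda>u. emeasure (\<kappa> u) rc_paths) \<in> borel_measurable (PiM {1..n} (\<lambda>_. lborel))" by simp
qed (use prob sets in \<open>auto intro: prob_space_imp_subprob_space\<close>)

definition hold_law :: "(nat \<Rightarrow> real) measure" where
  "hold_law = density (PiM {1..n} (\<lambda>_. lborel)) (\<lambda>u. \<Prod>k\<in>{1..n}. hold_density k (u k))"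

lemma sets_hold_law[measurable_cong]: "sets hold_law = sets (PiM {1..n} (\<lambda>_. lborel))"
  by (simp add: hold_law_def)

lemma nn_integral_hold_law:
  assumes [measurable]: "f \<in> borel_measurable (PiM {1..n} (\<lambda>_. lborel))"
  shows "(\<integral>\<^sup>+u. f u \<partial>hold_law) = hold_integral n 0 f"
proof -
  have "(\<lambda>u. \<Prod>k\<in>{1..n}. hold_density k (u k)) \<in> borel_measurable (PiM {1..n} (\<lambda>_. lborel))"
    by measurable
  from nn_integral_density[OF this assms] show ?thesis
    by (simp add: hold_law_def hold_integral_def)
qed

text \<open>Source of both the Laplace kernel and the constant that the factors
  \<open>1 / q k\<close> later remove.\<close>

lemma prod_hold_density:
  assumes "u \<in> space (PiM {1..n} (\<lambda>_. lborel))"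
  shows "(\<Prod>k\<in>{1..n}. hold_density k (u k))
    = ennreal (\<Prod>k\<in>{1..n}. q k) * ennreal (exp (- (\<Sum>k\<in>{1..n}. q k * u k))) * indicator (pos_orthant n) u"
proof (cases "u \<in> pos_orthant n")
  case True
  then have "(\<Prod>k\<in>{1..n}. hold_density k (u k)) = (\<Prod>k\<in>{1..n}. ennreal (q k * exp (- (q k * u k))))"
    by (intro prod.cong) (auto simp: hold_density_def pos_orthant_def)
  also have "\<dots> = ennreal (\<Prod>k\<in>{1..n}. q k * exp (- (q k * u k)))"
    using q_pos by (intro prod_ennreal) (simp add: less_imp_le)
  also have "(\<Prod>k\<in>{1..n}. q k * exp (- (q k * u k))) = (\<Prod>k\<in>{1..n}. q k) * exp (- (\<Sum>k\<in>{1..n}. q k * u k))"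
    by (simp add: prod.distrib exp_sum flip: sum_negf)
  moreover have "0 \<le> (\<Prod>k\<in>{1..n}. q k)" using q_pos by (intro prod_nonneg) (simp add: less_imp_le)
  ultimately show ?thesis
    using True by (simp add: ennreal_mult)
next
  case False
  then obtain k where "k \<in> {1..n}" "hold_density k (u k) = 0"
    by (auto simp: pos_orthant_def hold_density_def)
  then show ?thesis using False by (subst prod_zero) auto
qed

lemma path_law_mixture:
  fixes \<kappa> :: "(nat \<Rightarrow> real) \<Rightarrow> (real \<Rightarrow> 'e) measure" and Z :: "real \<Rightarrow> 'b \<Rightarrow> nat \<times> 'e"
  assumes \<kappa>: "\<kappa> \<in> PiM {1..n} (\<lambda>_. lborel) \<rightarrow>\<^sub>M subprob_algebra path_space"
    and cyl: "\<And>u J b. u \<in> pos_orthant n \<Longrightarrow> finite J \<Longrightarrow> J \<subseteq> {0..} \<Longrightarrow>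
      emeasure (\<kappa> u) (cylinder J b) = ennreal (path_prob (hold_trans G n 0 u) 0 i (observations J b))"
    and chain: "markov_chain N ({0..n} \<times> UNIV) (\<lambda>a b. aug_trans n G q (b - a)) Z"
    and start: "AE \<omega> in N. Z 0 \<omega> = (0, i)"
  shows "distr N path_space (\<lambda>\<omega> t. snd (Z t \<omega>)) = hold_law \<bind> \<kappa>"
proof (rule measure_eqI_generator_eq[OF Int_stable_cylinders cylinders_Pow, where A = "\<lambda>_. rc_paths"])
  interpret prob_space N using chain by (simp add: markov_chain_def)
  have [measurable]: "(\<lambda>\<omega> t. snd (Z t \<omega>)) \<in> N \<rightarrow>\<^sub>M path_space"
    by (rule markov_chain_path_measurable[OF chain])
  note [measurable] = \<kappa>
  have \<kappa>': "\<kappa> \<in> hold_law \<rightarrow>\<^sub>M subprob_algebra path_space" by measurable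
  have ne: "space hold_law \<noteq> {}" by (simp add: hold_law_def space_PiM PiE_eq_empty_iff)
  show "sets (distr N path_space (\<lambda>\<omega> t. snd (Z t \<omega>))) = sigma_sets rc_paths cylinders"
    by (simp add: sets_path_space)
  show "sets (hold_law \<bind> \<kappa>) = sigma_sets rc_paths cylinders"
    using sets_bind[OF sets_kernel[OF \<kappa>'] ne] by (simp add: sets_path_space)
  \<comment> \<open>With no prescribed times the cylinder is the whole space, so the constant
    sequence serves as the exhausting sequence of sets of finite mass.\<close>
  have "rc_paths = cylinder {} undefined" by (simp add: cylinder_def)
  then have "rc_paths \<in> cylinders" unfolding cylinders_def by blast
  then show "range (\<lambda>_::nat. rc_paths) \<subseteq> cylinders" by auto
  show "emeasure (distr N path_space (\<lambda>\<omega> t. snd (Z t \<omega>))) rc_paths \<noteq> \<infinity>" for k :: nat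
    by (subst emeasure_distr) (auto simp: emeasure_eq_measure sets.top[of path_space, simplified])
  fix A :: "(real \<Rightarrow> 'e) set" assume "A \<in> cylinders"
  then consider "A = {}" | J b where "A = cylinder J b" "finite J" "J \<subseteq> {0..}"
    by (auto simp: cylinders_def)
  then show "emeasure (distr N path_space (\<lambda>\<omega> t. snd (Z t \<omega>))) A = emeasure (hold_law \<bind> \<kappa>) A"
  proof cases
    case 2
    have A[measurable]: "A \<in> sets path_space" using 2 by (simp add: cylinder_in_sets)
    have "emeasure (distr N path_space (\<lambda>\<omega> t. snd (Z t \<omega>))) A = emeasure N {\<omega>\<in>space N. \<forall>t\<in>J. snd (Z t \<omega>) = b t}"
    proof -
      have "(\<lambda>\<omega> t. snd (Z t \<omega>)) -` A \<inter> space N = {\<omega>\<in>space N. \<forall>t\<in>J. snd (Z t \<omega>) = b t}"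
        by (auto simp: 2(1) cylinder_def intro: rc_paths_comp[OF markov_chain_rc_paths[OF chain]])
      then show ?thesis by (subst emeasure_distr) auto
    qed
    also have "\<dots> = ennreal (aug_path_prob n G q 0 i (observations J b))"
      by (simp add: emeasure_eq_measure aug_chain_cylinder[OF chain start 2(2,3)])
    also have "\<dots> = hold_integral n 0 (\<lambda>u. ennreal (path_prob (hold_trans G n 0 u) 0 i (observations J b)))"
      by (rule hold_integral_path_prob[symmetric]) (use observations_nonneg[OF 2(2,3)] in auto)
    also have "\<dots> = hold_integral n 0 (\<lambda>u. emeasure (\<kappa> u) A)"
      unfolding hold_integral_def
    proof (rule nn_integral_cong)
      fix u assume "u \<in> space (PiM {Suc 0..0 + n} (\<lambda>_. lborel :: real measure))"
      then have zero: "(\<Prod>k\<in>{Suc 0..0 + n}. hold_density k (u k)) = 0" if "u \<notin> pos_orthant n"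
        using prod_hold_density[of u] that by simp
      show "(\<Prod>k\<in>{Suc 0..0 + n}. hold_density k (u k)) * ennreal (path_prob (hold_trans G n 0 u) 0 i (observations J b))
        = (\<Prod>k\<in>{Suc 0..0 + n}. hold_density k (u k)) * emeasure (\<kappa> u) A"
        using cyl[OF _ 2(2,3)] 2(1) by (cases "u \<in> pos_orthant n") (simp_all only: zero mult_zero_left not_False_eq_True)
    qed
    also have "\<dots> = (\<integral>\<^sup>+u. emeasure (\<kappa> u) A \<partial>hold_law)"
      by (rule nn_integral_hold_law[symmetric]) (rule measurable_emeasure_kernel[OF \<kappa> A])
    also have "\<dots> = emeasure (hold_law \<bind> \<kappa>) A"
      by (rule emeasure_bind[OF ne \<kappa>' A, symmetric])
    finally show ?thesis .
  qed simp
qed auto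

lemma nn_integral_path_mixture:
  fixes \<kappa> :: "(nat \<Rightarrow> real) \<Rightarrow> (real \<Rightarrow> 'e) measure" and Z :: "real \<Rightarrow> 'b \<Rightarrow> nat \<times> 'e"
  assumes \<kappa>: "\<kappa> \<in> PiM {1..n} (\<lambda>_. lborel) \<rightarrow>\<^sub>M subprob_algebra path_space"
    and cyl: "\<And>u J b. u \<in> pos_orthant n \<Longrightarrow> finite J \<Longrightarrow> J \<subseteq> {0..} \<Longrightarrow>
      emeasure (\<kappa> u) (cylinder J b) = ennreal (path_prob (hold_trans G n 0 u) 0 i (observations J b))"
    and chain: "markov_chain N ({0..n} \<times> UNIV) (\<lambda>a b. aug_trans n G q (b - a)) Z"
    and start: "AE \<omega> in N. Z 0 \<omega> = (0, i)"
    and f[measurable]: "f \<in> borel_measurable path_space"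
  shows "(\<integral>\<^sup>+\<omega>. f (\<lambda>t. snd (Z t \<omega>)) \<partial>N) = ennreal (\<Prod>k\<in>{1..n}. q k) *
    (\<integral>\<^sup>+u\<in>pos_orthant n. (ennreal (exp (- (\<Sum>k\<in>{1..n}. q k * u k))) * (\<integral>\<^sup>+y. f y \<partial>\<kappa> u)) \<partial>PiM {1..n} (\<lambda>_. lborel))"
proof -
  note [measurable] = \<kappa>
  have \<kappa>': "\<kappa> \<in> hold_law \<rightarrow>\<^sub>M subprob_algebra path_space" by measurable
  have [measurable]: "(\<lambda>u. \<integral>\<^sup>+y. f y \<partial>\<kappa> u) \<in> borel_measurable (PiM {1..n} (\<lambda>_. lborel))"
    by (rule measurable_compose[OF \<kappa> nn_integral_measurable_subprob_algebra[OF f]])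
  have "(\<integral>\<^sup>+\<omega>. f (\<lambda>t. snd (Z t \<omega>)) \<partial>N) = (\<integral>\<^sup>+y. f y \<partial>distr N path_space (\<lambda>\<omega> t. snd (Z t \<omega>)))"
    by (rule nn_integral_distr[symmetric]) (auto intro: markov_chain_path_measurable[OF chain])
  also have "\<dots> = (\<integral>\<^sup>+u. \<integral>\<^sup>+y. f y \<partial>\<kappa> u \<partial>hold_law)"
    by (subst path_law_mixture[OF \<kappa> _ chain start]) (fact cyl, rule nn_integral_bind[OF f \<kappa>'])
  also have "\<dots> = hold_integral n 0 (\<lambda>u. \<integral>\<^sup>+y. f y \<partial>\<kappa> u)"
    by (rule nn_integral_hold_law) measurable
  also have "\<dots> = (\<integral>\<^sup>+u. ennreal (\<Prod>k\<in>{1..n}. q k) * (ennreal (exp (- (\<Sum>k\<in>{1..n}. q k * u k))) *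
      (\<integral>\<^sup>+y. f y \<partial>\<kappa> u) * indicator (pos_orthant n) u) \<partial>PiM {1..n} (\<lambda>_. lborel))"
    unfolding hold_integral_def One_nat_def[symmetric] add_0_left
    by (intro nn_integral_cong) (simp only: prod_hold_density mult_ac)
  also have "\<dots> = ennreal (\<Prod>k\<in>{1..n}. q k) *
    (\<integral>\<^sup>+u\<in>pos_orthant n. (ennreal (exp (- (\<Sum>k\<in>{1..n}. q k * u k))) * (\<integral>\<^sup>+y. f y \<partial>\<kappa> u)) \<partial>PiM {1..n} (\<lambda>_. lborel))"
    by (rule nn_integral_cmult) measurable
  finally show ?thesis .
qed

end

section \<open>From the mixture to the Laplace transform\<close>

lemma hold_kernel_exists:
  fixes G :: "nat \<Rightarrow> 'e::finite mat" and X :: "(nat \<Rightarrow> real) \<Rightarrow> real \<Rightarrow> 'a \<Rightarrow> 'e"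
  assumes X_chain: "\<forall>s. incr_times n s \<longrightarrow>
        markov_chain (M s) UNIV (pw_trans UNIV G n s) (X s) \<and>
        (\<forall>i. measure (M s) {\<omega>\<in>space (M s). X s 0 \<omega> = i} > 0)"
  obtains \<kappa> L where "\<And>u. prob_space (\<kappa> u)" "\<And>u. sets (\<kappa> u) = sets path_space"
    "\<And>u J b. u \<in> pos_orthant n \<Longrightarrow> finite J \<Longrightarrow> J \<subseteq> {0..} \<Longrightarrow>
      emeasure (\<kappa> u) (cylinder J b) = ennreal (path_prob (hold_trans G n 0 u) 0 i (observations J b))"
    "\<And>u. u \<notin> pos_orthant n \<Longrightarrow> \<kappa> u = L"
    "\<And>u. u \<in> pos_orthant n \<Longrightarrow> \<kappa> u = start_law (M (psums u)) (X (psums u)) i"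
proof -
  \<comment> \<open>Off the orthant \<open>psums u\<close> may fail to be increasing and no chain is
    given. The Dirac law of a constant path fills in: a probability measure on the right space that
    does not depend on \<open>u\<close>.\<close>
  define L :: "(real \<Rightarrow> 'e) measure" where "L = return path_space (\<lambda>_. i)"
  define \<kappa> where "\<kappa> u = (if u \<in> pos_orthant n then start_law (M (psums u)) (X (psums u)) i else L)" for u
  have const: "(\<lambda>_. i) \<in> rc_paths" by (auto simp: rc_paths_def intro: zero_less_one)
  have chain: "started_chain (M (psums u)) (pw_trans UNIV G n (psums u)) (X (psums u)) i" if "u \<in> pos_orthant n" for u
    using X_chain incr_times_psums[OF that] by unfold_locales auto
  show ?thesis
  proof (rule that)
    show "prob_space (\<kappa> u)" for u
      using started_chain.prob_space_start_law[OF chain] const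
      by (auto simp: \<kappa>_def L_def intro!: prob_space_return)
    show "sets (\<kappa> u) = sets path_space" for u
      by (simp add: \<kappa>_def L_def start_law_def)
    show "\<kappa> u = L" if "u \<notin> pos_orthant n" for u using that by (simp add: \<kappa>_def)
    show "\<kappa> u = start_law (M (psums u)) (X (psums u)) i" if "u \<in> pos_orthant n" for u
      using that by (simp add: \<kappa>_def)
    show "emeasure (\<kappa> u) (cylinder J b) = ennreal (path_prob (hold_trans G n 0 u) 0 i (observations J b))"
      if u: "u \<in> pos_orthant n" and J: "finite J" "J \<subseteq> {0..}" for u J b
    proof -
      have "path_prob (pw_trans UNIV G n (psums u)) (0 + 0) i (observations J b)
          = path_prob (hold_trans G n 0 u) 0 i (observations J b)"
        by (rule path_prob_shift[where c = 0])
           (use observations_nonneg[OF J] in \<open>auto simp: pw_trans_eq_hold_trans[OF u]\<close>)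
      then show ?thesis
        using started_chain.emeasure_start_law_cylinder[OF chain[OF u] J] u by (simp add: \<kappa>_def)
    qed
  qed
qed

text \<open>Stated for any measurable path functional with values in [0, 1], so that passage above 0
  and passage above \<open>t\<close> are two instances of one identity.\<close>

lemma is_inv_laplace_path_functional:
  fixes n :: nat and G :: "nat \<Rightarrow> 'e::finite mat"
    and M :: "(nat \<Rightarrow> real) \<Rightarrow> 'a measure" and X :: "(nat \<Rightarrow> real) \<Rightarrow> real \<Rightarrow> 'a \<Rightarrow> 'e"
    and Mz :: "(nat \<Rightarrow> real) \<Rightarrow> 'b measure" and Z :: "(nat \<Rightarrow> real) \<Rightarrow> real \<Rightarrow> 'b \<Rightarrow> nat \<times> 'e"
  assumes gen: "\<forall>k\<in>{1..n+1}. is_generator UNIV (G k)"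
    and X_chain: "\<forall>s. incr_times n s \<longrightarrow>
        markov_chain (M s) UNIV (pw_trans UNIV G n s) (X s) \<and>
        (\<forall>i. measure (M s) {\<omega>\<in>space (M s). X s 0 \<omega> = i} > 0)"
    and Z_chain: "\<And>q. (\<forall>k\<in>{1..n}. 0 < q k) \<Longrightarrow>
        markov_chain (Mz q) ({0..n} \<times> UNIV) (\<lambda>a b. aug_trans n G q (b - a)) (Z q)"
    and Z_start: "\<And>q. (\<forall>k\<in>{1..n}. 0 < q k) \<Longrightarrow> AE \<omega> in Mz q. Z q 0 \<omega> = (0, i)"
    and F[measurable]: "F \<in> borel_measurable path_space"
    and F_bounds: "\<And>y. 0 \<le> F y" "\<And>y. F y \<le> 1"
  shows "is_inv_laplace n
      (\<lambda>u. cond_exp_start (M (psums u)) (X (psums u)) i (\<lambda>\<omega>. F (\<lambda>r. X (psums u) r \<omega>)))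
      (\<lambda>q. (\<Prod>k\<in>{1..n}. 1 / q k) * (\<integral>\<omega>. F (\<lambda>r. snd (Z q r \<omega>)) \<partial>Mz q))"
proof -
  obtain \<kappa> L where \<kappa>: "\<And>u. prob_space (\<kappa> u)" "\<And>u. sets (\<kappa> u) = sets path_space"
    and cyl: "\<And>u J b. u \<in> pos_orthant n \<Longrightarrow> finite J \<Longrightarrow> J \<subseteq> {0..} \<Longrightarrow>
      emeasure (\<kappa> u) (cylinder J b) = ennreal (path_prob (hold_trans G n 0 u) 0 i (observations J b))"
    and outside: "\<And>u. u \<notin> pos_orthant n \<Longrightarrow> \<kappa> u = L"
    and law: "\<And>u. u \<in> pos_orthant n \<Longrightarrow> \<kappa> u = start_law (M (psums u)) (X (psums u)) i"
    using hold_kernel_exists[OF X_chain, of i] by blast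
  let ?f = "\<lambda>u. cond_exp_start (M (psums u)) (X (psums u)) i (\<lambda>\<omega>. F (\<lambda>r. X (psums u) r \<omega>))"
  have f: "ennreal (?f u) = (\<integral>\<^sup>+y. ennreal (F y) \<partial>\<kappa> u)" "0 \<le> ?f u" if u: "u \<in> pos_orthant n" for u
  proof -
    interpret started_chain "M (psums u)" "pw_trans UNIV G n (psums u)" "X (psums u)" i
      using X_chain incr_times_psums[OF u] by unfold_locales auto
    show "ennreal (?f u) = (\<integral>\<^sup>+y. ennreal (F y) \<partial>\<kappa> u)" "0 \<le> ?f u"
      using cond_exp_start_eq[OF F F_bounds] law[OF u] by simp_all
  qed
  have rates: "holding_rates n G q" if "\<forall>k\<in>{1..n}. 0 < q k" for q
    using gen that by unfold_locales auto
  \<comment> \<open>Measurability of the kernel does not involve the rates; unit rates merely give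
    access to the lemma.\<close>
  have \<kappa>_meas: "\<kappa> \<in> PiM {1..n} (\<lambda>_. lborel) \<rightarrow>\<^sub>M subprob_algebra path_space"
    using holding_rates.kernel_measurable[OF rates[of "\<lambda>_. 1"] \<kappa> cyl outside] by simp
  have [measurable]: "(\<lambda>u. \<integral>\<^sup>+y. ennreal (F y) \<partial>\<kappa> u) \<in> borel_measurable (PiM {1..n} (\<lambda>_. lborel))"
    by (rule measurable_compose[OF \<kappa>_meas nn_integral_measurable_subprob_algebra]) measurable
  have [measurable]: "Measurable.pred (PiM {1..n} (\<lambda>_. lborel)) (\<lambda>u. u \<in> pos_orthant n)"
    unfolding pos_orthant_def mem_Collect_eq by measurable
  show ?thesis
    unfolding is_inv_laplace_def
  proof (intro conjI allI impI)
    \<comment> \<open>On the orthant the real conditional expectation is recovered from the kernel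
      integral by \<open>enn2real\<close>, and so inherits its measurability.\<close>
    have "(\<lambda>u. indicator (pos_orthant n) u * ?f u)
        = (\<lambda>u. if u \<in> pos_orthant n then enn2real (\<integral>\<^sup>+y. ennreal (F y) \<partial>\<kappa> u) else 0)"
      using f by (auto simp: fun_eq_iff simp flip: f(1))
    also have "\<dots> \<in> borel_measurable (PiM {1..n} (\<lambda>_. lborel))" by measurable
    finally show "(\<lambda>u. indicator (pos_orthant n) u * ?f u) \<in> borel_measurable (PiM {1..n} (\<lambda>_. lborel))" .
  next
    fix q :: "nat \<Rightarrow> real" assume q: "\<forall>k\<in>{1..n}. 0 < q k"
    interpret holding_rates n G q by (rule rates[OF q])
    interpret prob_space "Mz q" using Z_chain[OF q] by (simp add: markov_chain_def)
    have [measurable]: "(\<lambda>\<omega> t. snd (Z q t \<omega>)) \<in> Mz q \<rightarrow>\<^sub>M path_space"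
      by (rule markov_chain_path_measurable[OF Z_chain[OF q]])
    let ?Q = "\<Prod>k\<in>{1..n}. q k"
    let ?I = "\<integral>\<^sup>+u\<in>pos_orthant n. ennreal (?f u * exp (- (\<Sum>k\<in>{1..n}. q k * u k))) \<partial>PiM {1..n} (\<lambda>_. lborel)"
    have Q: "0 < ?Q" using q by (intro prod_pos) auto
    have "ennreal (\<integral>\<omega>. F (\<lambda>r. snd (Z q r \<omega>)) \<partial>Mz q) = (\<integral>\<^sup>+\<omega>. ennreal (F (\<lambda>r. snd (Z q r \<omega>))) \<partial>Mz q)"
      by (intro nn_integral_eq_integral[symmetric] integrable_const_bound[where B = 1])
         (use F_bounds in auto)
    also have "\<dots> = ennreal ?Q * (\<integral>\<^sup>+u\<in>pos_orthant n. (ennreal (exp (- (\<Sum>k\<in>{1..n}. q k * u k))) *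
        (\<integral>\<^sup>+y. ennreal (F y) \<partial>\<kappa> u)) \<partial>PiM {1..n} (\<lambda>_. lborel))"
      by (rule nn_integral_path_mixture[OF \<kappa>_meas cyl Z_chain[OF q] Z_start[OF q]]) measurable
    also have "(\<integral>\<^sup>+u\<in>pos_orthant n. (ennreal (exp (- (\<Sum>k\<in>{1..n}. q k * u k))) *
        (\<integral>\<^sup>+y. ennreal (F y) \<partial>\<kappa> u)) \<partial>PiM {1..n} (\<lambda>_. lborel)) = ?I"
      by (intro nn_integral_cong)
         (auto split: split_indicator simp: ennreal_mult'' f mult.commute simp flip: f(1))
    finally have "ennreal (\<Prod>k\<in>{1..n}. 1 / q k) * ennreal (\<integral>\<omega>. F (\<lambda>r. snd (Z q r \<omega>)) \<partial>Mz q)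
        = ennreal (\<Prod>k\<in>{1..n}. 1 / q k) * (ennreal ?Q * ?I)" by simp
    also have "\<dots> = ennreal ((\<Prod>k\<in>{1..n}. 1 / q k) * ?Q) * ?I"
      using q Q by (subst ennreal_mult) (auto simp: mult.assoc intro!: prod_nonneg)
    also have "(\<Prod>k\<in>{1..n}. 1 / q k) * ?Q = 1"
      unfolding prod.distrib[symmetric] using q by (intro prod.neutral) force
    finally show "?I = ennreal ((\<Prod>k\<in>{1..n}. 1 / q k) * (\<integral>\<omega>. F (\<lambda>r. snd (Z q r \<omega>)) \<partial>Mz q))"
      using F_bounds by (simp add: ennreal_mult'' integral_nonneg_AE)
  qed
qed

theorem theorem3p7:
  fixes n :: nat
    and G :: "nat \<Rightarrow> 'e::finite \<Rightarrow> 'e \<Rightarrow> real"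
    and v :: "'e \<Rightarrow> real"
    and c :: real
    and M :: "(nat \<Rightarrow> real) \<Rightarrow> 'a measure"
    and X :: "(nat \<Rightarrow> real) \<Rightarrow> real \<Rightarrow> 'a \<Rightarrow> 'e"
    and Mz :: "(nat \<Rightarrow> real) \<Rightarrow> 'e \<Rightarrow> 'b measure"
    and Z :: "(nat \<Rightarrow> real) \<Rightarrow> 'e \<Rightarrow> real \<Rightarrow> 'b \<Rightarrow> nat \<times> 'e"
  assumes gen: "\<forall>k\<in>{1..n+1}. is_generator UNIV (G k)"
    and v_nz: "\<forall>i. v i \<noteq> 0"
    and c_pos: "c > 0"
    and X_chain: "\<forall>s. incr_times n s \<longrightarrow>
        markov_chain (M s) UNIV (pw_trans UNIV G n s) (X s) \<and>
        (\<forall>i. measure (M s) {\<omega>\<in>space (M s). X s 0 \<omega> = i} > 0)"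
    and Z_chain: "\<forall>q. (\<forall>k\<in>{1..n}. 0 < q k) \<longrightarrow> (\<forall>i.
        markov_chain (Mz q i) ({0..n} \<times> UNIV)
          (\<lambda>a b. mat_exp ({0..n} \<times> UNIV) (mat_scale (b - a) (aug_gen n G q))) (Z q i) \<and>
        (AE \<omega> in Mz q i. Z q i 0 \<omega> = (0, i)))"
  shows "(\<forall>i j. v i < 0 \<longrightarrow> v j > 0 \<longrightarrow>
            is_inv_laplace n
              (\<lambda>u. cond_exp_start (M (psums u)) (X (psums u)) i
                     (\<lambda>\<omega>. passage_fun c v (\<lambda>r. X (psums u) r \<omega>) 0 j))
              (\<lambda>q. (\<Prod>k\<in>{1..n}. 1 / q k) *
                     (\<integral>\<omega>. passage_fun c v (\<lambda>r. snd (Z q i r \<omega>)) 0 j \<partial>Mz q i)))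
       \<and> (\<forall>t>0. \<forall>i j. v i > 0 \<longrightarrow> v j > 0 \<longrightarrow>
            is_inv_laplace n
              (\<lambda>u. cond_exp_start (M (psums u)) (X (psums u)) i
                     (\<lambda>\<omega>. passage_fun c v (\<lambda>r. X (psums u) r \<omega>) t j))
              (\<lambda>q. (\<Prod>k\<in>{1..n}. 1 / q k) *
                     (\<integral>\<omega>. passage_fun c v (\<lambda>r. snd (Z q i r \<omega>)) t j \<partial>Mz q i)))"
proof -
  have *: "is_inv_laplace n
      (\<lambda>u. cond_exp_start (M (psums u)) (X (psums u)) i
             (\<lambda>\<omega>. passage_fun c v (\<lambda>r. X (psums u) r \<omega>) t j))
      (\<lambda>q. (\<Prod>k\<in>{1..n}. 1 / q k) *
             (\<integral>\<omega>. passage_fun c v (\<lambda>r. snd (Z q i r \<omega>)) t j \<partial>Mz q i))" for i j t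
    using Z_chain c_pos
    by (intro is_inv_laplace_path_functional[OF gen X_chain _ _ passage_fun_measurable passage_fun_bounds]) auto
  then show ?thesis by blast
qed

end
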